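(* Let $\theta>0$ and let $s:[0,\infty)\to[0,\infty)$ be locally absolutely continuous on $[0,\infty)$, strictly increasing with $s(0)=0$ and $s(1)=1$, satisfying $$s(x+1)\le s(x)+1\quad\text{for all }x\ge0\qquad\text{and}\qquad|s(x+1)-s(y+1)|\le|s(x)-s(y)|\quad\text{for all }x,y\ge0,$$ and such that $E[D_{\theta,s}]<\infty$. Let $$I(x)=\frac{\theta s'(x)}{s^{\theta+1}(x)}\int_0^xs^\theta(v)\,dv$$ for $x>0$ such that $s'(x)$ exists. If there exists $\rho\in[0,1)$ such that $\|I\|_\infty\le\rho$, then for any non-negative random variable $W$ with finite mean, $$d_1(W,D_{\theta,s})\le(1-\rho)^{-1}d_1(W^*,W),$$ where $W^*=_ds^{-1}(U^{1/\theta}s(W+1))$ with $U\sim\mathcal{U}[0,1]$ independent of $W$. In the special case $s(x)=x$, $\|I\|_\infty=\theta/(\theta+1)\in[0,1)$, and one may take $\rho$ equal to this value.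
   Context: $=_d$ denotes equality in distribution; $\|\cdot\|_\infty$ is the essential supremum norm with respect to Lebesgue measure (over $x>0$). A function on $[0,\infty)$ is locally absolutely continuous if it is absolutely continuous on every compact subinterval. $D_{\theta,s}$ denotes a random variable whose law $\mathcal{D}_{\theta,s}$ is the unique law of a non-negative random variable $D$ such that $s(D)$ has finite mean and $D=_ds^{-1}(U^{1/\theta}s(D+1))$ with $U\sim\mathcal{U}[0,1]$ independent of $D$ (this law exists and is unique under the stated conditions on $s$). The Wasserstein distance is $d_1(X,Y)=\sup_{h}|Eh(X)-Eh(Y)|$ over all $h$ with $|h(x)-h(y)|\le|x-y|$; equivalently $d_1(X,Y)=\inf E|X-Y|$ over all joint distributions with the given marginals. *)

theory Defs
  imports "HOL-Probability.Probability" "HOL-Probability.Essential_Supremum"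
begin

definition absolutely_continuous_on_interval :: "real \<Rightarrow> real \<Rightarrow> (real \<Rightarrow> real) \<Rightarrow> bool" where
  "absolutely_continuous_on_interval c d f \<longleftrightarrow>
     (\<forall>\<epsilon>>0. \<exists>\<delta>>0. \<forall>(n::nat) (a::nat \<Rightarrow> real) (b::nat \<Rightarrow> real).
        (\<forall>i<n. c \<le> a i \<and> a i \<le> b i \<and> b i \<le> d) \<longrightarrow>
        disjoint_family_on (\<lambda>i. {a i<..<b i}) {..<n} \<longrightarrow>
        (\<Sum>i<n. b i - a i) < \<delta> \<longrightarrow>
        (\<Sum>i<n. \<bar>f (b i) - f (a i)\<bar>) < \<epsilon>)"

text \<open>
  A function \<open>s : [0, \<infinity>) \<rightarrow> [0, \<infinity>)\<close> is represented by a total function on the reals of which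
  only the values on \<open>{0..}\<close> are constrained or used.
\<close>

definition utility_function :: "(real \<Rightarrow> real) \<Rightarrow> bool" where
  "utility_function s \<longleftrightarrow>
     s \<in> {0..} \<rightarrow> {0..} \<and>
     (\<forall>c d. 0 \<le> c \<longrightarrow> c \<le> d \<longrightarrow> absolutely_continuous_on_interval c d s) \<and>
     strict_mono_on {0..} s \<and> s 0 = 0 \<and> s 1 = 1 \<and>
     (\<forall>x\<ge>0. s (x + 1) \<le> s x + 1) \<and>
     (\<forall>x\<ge>0. \<forall>y\<ge>0. \<bar>s (x + 1) - s (y + 1)\<bar> \<le> \<bar>s x - s y\<bar>)"

text \<open>
  The law of \<open>s\<^sup>-\<^sup>1 (U\<^bsup>1/\<theta>\<^esup> s (W + 1))\<close> with \<open>U\<close> uniform on \<open>[0, 1]\<close> and independent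
  of \<open>W\<close>; independence is realised by the product measure. For \<open>u \<in> [0, 1]\<close> and \<open>W \<omega> \<ge> 0\<close> the
  argument of the inverse lies in \<open>[0, s (W \<omega> + 1)]\<close>, hence in the image of \<open>{0..}\<close> under \<open>s\<close>, even
  when \<open>s\<close> is bounded.
\<close>

definition star_law :: "real \<Rightarrow> (real \<Rightarrow> real) \<Rightarrow> 'a measure \<Rightarrow> ('a \<Rightarrow> real) \<Rightarrow> real measure" where
  "star_law \<theta> s M W =
     distr (uniform_measure lborel {0..1} \<Otimes>\<^sub>M M) borel
       (\<lambda>(u, \<omega>). the_inv_into {0..} s (u powr (1 / \<theta>) * s (W \<omega> + 1)))"

definition nonneg_random_variable :: "'a measure \<Rightarrow> ('a \<Rightarrow> real) \<Rightarrow> bool" where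
  "nonneg_random_variable M X \<longleftrightarrow>
     prob_space M \<and> X \<in> borel_measurable M \<and> (\<forall>\<omega>\<in>space M. 0 \<le> X \<omega>)"

text \<open>
  \<open>D\<close>, defined on the probability space \<open>N\<close>, has the law \<open>\<D>\<^bsub>\<theta>,s\<^esub>\<close>. Under the conditions on
  \<open>s\<close> this property determines the law of \<open>D\<close>.
\<close>

definition dickman_variable :: "real \<Rightarrow> (real \<Rightarrow> real) \<Rightarrow> 'a measure \<Rightarrow> ('a \<Rightarrow> real) \<Rightarrow> bool" where
  "dickman_variable \<theta> s N D \<longleftrightarrow>
     nonneg_random_variable N D \<and> integrable N (\<lambda>\<omega>. s (D \<omega>)) \<and>
     distr N borel D = star_law \<theta> s N D"

text \<open>
  The Wasserstein distance as a function of the laws. It is meaningful for laws of finite mean, for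
  which every Lipschitz function is integrable.
\<close>

definition wasserstein :: "real measure \<Rightarrow> real measure \<Rightarrow> ennreal" where
  "wasserstein \<mu> \<nu> =
     (SUP h\<in>{h :: real \<Rightarrow> real. 1-lipschitz_on UNIV h}.
        ennreal \<bar>(LINT x|\<mu>. h x) - (LINT x|\<nu>. h x)\<bar>)"

text \<open>
  At the points where \<open>s\<close> is not differentiable, a Lebesgue null set, \<open>deriv s\<close> takes an unspecified
  value, which the essential supremum with respect to Lebesgue measure ignores.
\<close>

definition dickman_I :: "real \<Rightarrow> (real \<Rightarrow> real) \<Rightarrow> real \<Rightarrow> real" where
  "dickman_I \<theta> s x =
     \<theta> * deriv s x / s x powr (\<theta> + 1) * integral {0..x} (\<lambda>v. s v powr \<theta>)"

definition ess_sup_norm :: "(real \<Rightarrow> real) \<Rightarrow> ereal" where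
  "ess_sup_norm f = esssup (lebesgue_on {0<..}) (\<lambda>x. ereal \<bar>f x\<bar>)"

end

theory Submission
  imports Defs
begin

text \<open>
  The map that sends the law of \<open>W\<close> to the law of \<open>W\<^sup>*\<close> is a contraction with factor
  \<open>\<rho>\<close> for the Wasserstein distance, and the law of \<open>D\<close> is its fixed point. Hence
  \<open>d\<^sub>1(W, D) \<le> d\<^sub>1(W, W\<^sup>*) + d\<^sub>1(W\<^sup>*, D\<^sup>*) \<le> d\<^sub>1(W\<^sup>*, W) + \<rho> d\<^sub>1(W, D)\<close>,
  and \<open>d\<^sub>1(W, D)\<close> is finite because both means are (\<open>wasserstein_finite\<close>), so it can be
  moved to the left (\<open>dickman_wasserstein_bound\<close>).

  By duality the contraction says that \<open>g(w) = E h(s\<^sup>-\<^sup>1(U\<^bsup>1/\<theta>\<^esup> s(w + 1)))\<close> is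
  \<open>\<rho>\<close>-Lipschitz whenever \<open>h\<close> is 1-Lipschitz. Since \<open>s\<^sup>-\<^sup>1(U\<^bsup>1/\<theta>\<^esup> s(x))\<close> increases with
  \<open>x\<close>, the increments of \<open>g\<close> are dominated by those of \<open>m(x) = E s\<^sup>-\<^sup>1(U\<^bsup>1/\<theta>\<^esup> s(x))\<close>, the case
  where \<open>h\<close> is the identity. The layer-cake formula evaluates this mean (\<open>mean_q\<close>):
  \<open>m(x) = \<integral>\<^sub>0\<^sup>x P(U\<^bsup>1/\<theta>\<^esup> s(x) > s(v)) dv = x - s(x)\<^bsup>-\<theta>\<^esup> \<integral>\<^sub>0\<^sup>x s(v)\<^sup>\<theta> dv\<close>,
  and, formally, differentiation gives \<open>m'(x) = I(x)\<close>. So \<open>\<parallel>I\<parallel>\<^sub>\<infinity> \<le> \<rho>\<close> bounds the slope of \<open>m\<close>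
  almost everywhere, which suffices because \<open>s\<close> is absolutely continuous.

  The last step is made precise without differentiating \<open>m\<close>. With \<open>I = K s'\<close> and \<open>K\<close> continuous,
  \<open>mean_q_increment\<close> bounds increments of \<open>m\<close> by \<open>K\<close> times increments of \<open>s\<close>, up to an error that
  is negligible on short intervals. Near a given point \<open>K\<close> is almost constant, so there the
  hypothesis on \<open>I\<close> is an almost everywhere bound on \<open>s'\<close>, which integrates to a bound on
  increments of \<open>s\<close> (\<open>s_increment_le\<close>). Bisection (Bolzano's lemma) passes from the local bounds to
  the global one.

  The measure-theoretic core is therefore: an increasing absolutely continuous function is
  differentiable almost everywhere (\<open>AE_has_derivative\<close>), so that an assumption on \<open>s'\<close> has content,
  and an almost everywhere bound on its derivative bounds its increments
  (\<open>increment_le_of_derivative_le\<close>). Both follow from one application of Vitali's covering theorem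
  (\<open>vitali_measure_comparison\<close>): if a measure without singular part is at most \<open>c\<close> times an outer
  regular one on arbitrarily short intervals around every point of a set, then the same holds for the
  set. It is used for Lebesgue
  measure and the Stieltjes measure of the function, in both orders.
\<close>

section \<open>Comparison of measures by Vitali coverings\<close>

text \<open>
  The short intervals on which \<open>\<nu> \<le> c \<mu>\<close> form a Vitali cover of \<open>E\<close>, so disjoint ones among them
  exhaust \<open>E\<close> up to a Lebesgue null set, which \<open>\<nu>\<close> does not charge. They can be kept inside an open
  set \<open>U\<close> around \<open>E\<close>; summing over them gives \<open>\<nu> E \<le> c \<mu> U\<close>, and outer regularity of \<open>\<mu>\<close> shrinks
  \<open>U\<close> to \<open>E\<close>.
\<close>

lemma vitali_measure_comparison:
  fixes \<nu> \<mu> :: "real measure" and c :: real and E :: "real set"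
  assumes sets: "sets \<nu> = sets borel" "sets \<mu> = sets borel"
    and ac: "absolutely_continuous lborel \<nu>"
    and outer: "\<And>e::real. 0 < e \<Longrightarrow> \<exists>U. open U \<and> E \<subseteq> U \<and> emeasure \<mu> U \<le> emeasure \<mu> E + e"
    and E: "E \<in> sets borel" and c: "0 \<le> c"
    and fine: "\<And>x d. x \<in> E \<Longrightarrow> 0 < d \<Longrightarrow> \<exists>u v. u < v \<and> x \<in> {u..v} \<and> v - u < d \<and>
                  emeasure \<nu> {u..v} \<le> ennreal c * emeasure \<mu> {u..v}"
  shows "emeasure \<nu> E \<le> ennreal c * emeasure \<mu> E"
proof -
  have bound: "emeasure \<nu> E \<le> ennreal c * emeasure \<mu> U" if U: "open U" "E \<subseteq> U" for U
  proof -
    define K where "K = {(u,v). u < v \<and> {u..v} \<subseteq> U \<and> emeasure \<nu> {u..v} \<le> ennreal c * emeasure \<mu> {u..v}}"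
    define a r where "a = (\<lambda>(u,v). (u + v) / 2 :: real)" and "r = (\<lambda>(u,v). (v - u) / 2 :: real)"
    have cb: "cball (a i) (r i) = {fst i..snd i}" for i
      by (cases i) (simp add: a_def r_def cball_eq_atLeastAtMost field_simps)
    have small: "\<exists>i. i \<in> K \<and> x \<in> cball (a i) (r i) \<and> r i < d" if x: "x \<in> E" and d: "0 < d" for x d
    proof -
      obtain e where e: "e > 0" "ball x e \<subseteq> U"
        using U x by (meson open_contains_ball subsetD)
      obtain u v where uv: "u < v" "x \<in> {u..v}" "v - u < min d e"
          "emeasure \<nu> {u..v} \<le> ennreal c * emeasure \<mu> {u..v}"
        using fine[OF x, of "min d e"] d e by auto
      have "{u..v} \<subseteq> ball x e"
        using uv by (auto simp: dist_real_def)
      with e uv have "(u,v) \<in> K" by (auto simp: K_def)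
      moreover have "x \<in> cball (a (u,v)) (r (u,v))" using uv by (simp add: cb)
      moreover have "r (u,v) < d" using uv by (simp add: r_def)
      ultimately show ?thesis by blast
    qed
    have rpos: "0 < r i" if "i \<in> K" for i using that by (auto simp: K_def r_def)
    obtain C where C: "countable C" "C \<subseteq> K"
        "pairwise (\<lambda>i j. disjnt (cball (a i) (r i)) (cball (a j) (r j))) C"
        "negligible (E - (\<Union>i \<in> C. cball (a i) (r i)))"
      by (rule Vitali_covering_theorem_cballs[of K r E a, OF rpos small])
    let ?I = "\<lambda>i::real\<times>real. {fst i..snd i}"
    have IU: "(\<Union>i\<in>C. ?I i) \<in> sets borel" using C(1) by (intro sets.countable_UN'') auto
    have disj: "disjoint_family_on ?I C"
      using C(3) by (auto simp: cb disjoint_family_on_def pairwise_def disjnt_def)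
    have "E - (\<Union>i\<in>C. ?I i) \<in> null_sets lborel"
      using C(4) E IU unfolding cb negligible_iff_null_sets null_sets_def
      by (auto simp: emeasure_completion)
    then have null: "E - (\<Union>i\<in>C. ?I i) \<in> null_sets \<nu>"
      using ac by (auto simp: absolutely_continuous_def)
    have "emeasure \<nu> E \<le> emeasure \<nu> ((\<Union>i\<in>C. ?I i) \<union> (E - (\<Union>i\<in>C. ?I i)))"
      using E IU by (intro emeasure_mono) (auto simp: sets)
    also have "\<dots> = emeasure \<nu> (\<Union>i\<in>C. ?I i)"
      using null IU by (intro emeasure_Un_null_set) (auto simp: sets)
    also have "\<dots> = (\<integral>\<^sup>+i. emeasure \<nu> (?I i) \<partial>count_space C)"
      using C(1) disj by (intro emeasure_UN_countable) (auto simp: sets)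
    also have "\<dots> \<le> (\<integral>\<^sup>+i. ennreal c * emeasure \<mu> (?I i) \<partial>count_space C)"
      using C(2) by (intro nn_integral_mono) (auto simp: K_def)
    also have "\<dots> = ennreal c * (\<integral>\<^sup>+i. emeasure \<mu> (?I i) \<partial>count_space C)"
      by (intro nn_integral_cmult) auto
    also have "(\<integral>\<^sup>+i. emeasure \<mu> (?I i) \<partial>count_space C) = emeasure \<mu> (\<Union>i\<in>C. ?I i)"
      using C(1) disj by (intro emeasure_UN_countable[symmetric]) (auto simp: sets)
    also have "ennreal c * \<dots> \<le> ennreal c * emeasure \<mu> U"
      using C(2) U by (intro mult_left_mono emeasure_mono) (fastforce simp: K_def sets)+
    finally show ?thesis .
  qed
  show ?thesis
  proof (rule ennreal_le_epsilon)
    \<comment> \<open>The excess of \<open>\<mu> U\<close> is multiplied by \<open>c\<close>; dividing by \<open>c + 1\<close> also covers \<open>c = 0\<close>.\<close>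
    fix e :: real assume e: "0 < e"
    obtain U where U: "open U" "E \<subseteq> U" "emeasure \<mu> U \<le> emeasure \<mu> E + ennreal (e / (c + 1))"
      using outer[of "e / (c+1)"] e c by auto
    have "emeasure \<nu> E \<le> ennreal c * emeasure \<mu> U" by (rule bound[OF U(1,2)])
    also have "\<dots> \<le> ennreal c * (emeasure \<mu> E + ennreal (e / (c + 1)))"
      by (intro mult_left_mono U) auto
    also have "\<dots> = ennreal c * emeasure \<mu> E + ennreal (c * (e / (c + 1)))"
      using c e by (simp only: distrib_left) (simp add: ennreal_mult[symmetric])
    also have "\<dots> \<le> ennreal c * emeasure \<mu> E + ennreal e"
      using c e by (intro add_left_mono ennreal_leI) (auto simp: field_simps)
    finally show "emeasure \<nu> E \<le> ennreal c * emeasure \<mu> E + ennreal e" .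
  qed
qed

lemma lborel_outer_open:
  fixes E :: "real set"
  assumes "E \<in> sets borel" "0 < (e::real)"
  shows "\<exists>U. open U \<and> E \<subseteq> U \<and> emeasure lborel U \<le> emeasure lborel E + e"
proof -
  obtain U where U: "open U" "E \<subseteq> U" "emeasure lborel (U - E) < e"
    using outer_regular_lborel[OF assms] by blast
  have "emeasure lborel U = emeasure lborel (E \<union> (U - E))" using U by (simp add: Un_absorb1)
  also have "\<dots> \<le> emeasure lborel E + emeasure lborel (U - E)"
    using U assms by (intro emeasure_subadditive) auto
  also have "\<dots> \<le> emeasure lborel E + e" using U by (intro add_left_mono) auto
  finally show ?thesis using U by blast
qed

lemma finite_measure_outer_open:
  fixes E :: "real set"
  assumes M: "sets M = sets borel" "finite_measure M" and E: "E \<in> sets borel" and e: "0 < (e::real)"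
  shows "\<exists>U. open U \<and> E \<subseteq> U \<and> emeasure M U \<le> emeasure M E + e"
proof -
  have fin: "emeasure M E \<noteq> \<infinity>" using M(2) by (simp add: finite_measure.emeasure_finite)
  have "emeasure M E = (INF U\<in>{U. E \<subseteq> U \<and> open U}. emeasure M U)"
    using outer_regular[OF M(1) _ E] M by (simp add: finite_measure.emeasure_finite)
  moreover have "emeasure M E < emeasure M E + e"
    using fin e by (cases "emeasure M E") (auto simp flip: ennreal_plus simp: ennreal_less_iff)
  ultimately have "\<exists>U\<in>{U. E \<subseteq> U \<and> open U}. emeasure M U < emeasure M E + e"
    by (metis (no_types, lifting) INF_less_iff)
  then show ?thesis by (auto intro: less_imp_le)
qed

section \<open>Derivatives of increasing absolutely continuous functions\<close>

text \<open>
  Points where arbitrarily short intervals have slope below \<open>p\<close>. Open intervals around the point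
  are used in place of one-sided difference quotients, which makes the set a \<open>G\<^sub>\<delta>\<close> for any \<open>F\<close>. Applied to
  \<open>-F\<close> and \<open>-p\<close>, the definition gives the points with short intervals of slope above \<open>p\<close>.
\<close>

definition slow_points :: "(real \<Rightarrow> real) \<Rightarrow> real \<Rightarrow> real set" where
  "slow_points F p = {x. \<forall>d>0. \<exists>u v. u < x \<and> x < v \<and> v - u < d \<and> F v - F u < p * (v - u)}"

lemma slow_pointsD:
  "x \<in> slow_points F p \<Longrightarrow> 0 < d \<Longrightarrow> \<exists>u v. u < x \<and> x < v \<and> v - u < d \<and> F v - F u < p * (v - u)"
  by (simp add: slow_points_def)

lemma slow_points_borel: "slow_points F p \<in> sets borel"
proof -
  let ?U = "\<lambda>n::nat. \<Union>{{u<..<v} |u v. v - u < 1 / real (Suc n) \<and> F v - F u < p * (v - u)}"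
  have eq: "slow_points F p = (\<Inter>n. ?U n)"
  proof (intro equalityI subsetI)
    fix x assume "x \<in> slow_points F p"
    show "x \<in> (\<Inter>n. ?U n)"
    proof
      fix n :: nat
      obtain u v where "u < x" "x < v" "v - u < 1 / real (Suc n)" "F v - F u < p * (v - u)"
        using slow_pointsD[OF \<open>x \<in> slow_points F p\<close>, of "1 / real (Suc n)"] by auto
      then show "x \<in> ?U n" by (intro UnionI[of "{u<..<v}"]) auto
    qed
  next
    fix x assume x: "x \<in> (\<Inter>n. ?U n)"
    show "x \<in> slow_points F p"
      unfolding slow_points_def
    proof safe
      fix d :: real assume "0 < d"
      then obtain n where n: "1 / real (Suc n) < d"
        using nat_approx_posE by blast
      have "x \<in> ?U n" using x by blast
      then obtain u v where "u < x" "x < v" "v - u < 1 / real (Suc n)" "F v - F u < p * (v - u)"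
        by force
      with n show "\<exists>u v. u < x \<and> x < v \<and> v - u < d \<and> F v - F u < p * (v - u)"
        by (meson less_trans)
    qed
  qed
  have "open (?U n)" for n by (rule open_Union) auto
  then show ?thesis unfolding eq by (intro sets.countable_INT'') auto
qed

text \<open>
  By continuity, an interval with end point \<open>x\<close> can be enlarged slightly beyond \<open>x\<close> while its slope
  stays below \<open>p\<close>.
\<close>

lemma frequently_slope_less_imp_slow:
  fixes G :: "real \<Rightarrow> real"
  assumes cont: "continuous_on UNIV G"
    and freq: "\<exists>\<^sub>F y in at x. (G y - G x) / (y - x) < p"
  shows "x \<in> slow_points G p"
  unfolding slow_points_def
proof safe
  fix d :: real assume d: "0 < d"
  have "\<forall>\<^sub>F y in at x. \<bar>y - x\<bar> < d / 2"
    using d by (auto simp: eventually_at dist_real_def intro!: exI[of _ "d/2"])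
  moreover have "\<forall>\<^sub>F y in at x. y \<noteq> x" by (simp add: eventually_neq_at_within)
  ultimately have "\<exists>\<^sub>F y in at x. (G y - G x) / (y - x) < p \<and> \<bar>y - x\<bar> < d / 2 \<and> y \<noteq> x"
    using freq by (intro frequently_eventually_frequently eventually_conj)
  then obtain y where y: "(G y - G x) / (y - x) < p" "\<bar>y - x\<bar> < d / 2" "y \<noteq> x"
    using frequently_ex by blast
  \<comment> \<open>With \<open>w\<close> in place of \<open>x\<close>, the slope between \<open>w\<close> and \<open>y\<close> is below \<open>p\<close> iff \<open>H w > 0\<close>;
    the sign treats \<open>x < y\<close> and \<open>y < x\<close> together.\<close>
  define H where "H = (\<lambda>w. p * \<bar>y - w\<bar> - sgn (y - x) * (G y - G w))"
  have "isCont H x"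
    unfolding H_def using cont by (intro continuous_intros) (auto simp: continuous_on_eq_continuous_at)
  moreover have "H x > 0"
    using y by (cases "y > x") (auto simp: H_def field_simps sgn_if)
  ultimately have "\<forall>\<^sub>F w in at x. H w > 0"
    by (simp add: isCont_def order_tendsto_iff)
  then obtain e where e: "e > 0" "\<And>w. w \<noteq> x \<Longrightarrow> \<bar>w - x\<bar> < e \<Longrightarrow> H w > 0"
    by (auto simp: eventually_at dist_real_def)
  define k where "k = min (e / 2) (d / 2)"
  have k: "0 < k" "k < e" "k \<le> d / 2" using e d by (auto simp: k_def)
  show "\<exists>u v. u < x \<and> x < v \<and> v - u < d \<and> G v - G u < p * (v - u)"
  proof (cases "y > x")
    case True
    then show ?thesis using e(2)[of "x - k"] k y
      by (intro exI[of _ "x - k"] exI[of _ y]) (auto simp: H_def sgn_if)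
  next
    case False
    then show ?thesis using e(2)[of "x + k"] k y
      by (intro exI[of _ y] exI[of _ "x + k"]) (auto simp: H_def sgn_if)
  qed
qed

text \<open>
  The function is constant outside \<open>{a..b}\<close>, so that its Stieltjes measure is finite and hence outer
  regular.
\<close>

locale ac_distribution_function =
  fixes F :: "real \<Rightarrow> real" and a b :: real
  assumes ab: "a \<le> b"
    and mono_F: "\<And>x y. x \<le> y \<Longrightarrow> F x \<le> F y"
    and cont_F: "continuous_on UNIV F"
    and clamp_F: "\<And>x. F x = F (max a (min b x))"
    and ac_F: "absolutely_continuous_on_interval a b F"
begin

abbreviation \<mu> :: "real measure" where "\<mu> \<equiv> interval_measure F"

lemma emeasure_Icc: "u \<le> v \<Longrightarrow> emeasure \<mu> {u..v} = ennreal (F v - F u)"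
  using emeasure_interval_measure_Icc[OF _ mono_F cont_F] by auto

lemma outside_null: "UNIV - {a..b} \<in> null_sets \<mu>"
proof -
  have "{a - real n..a} \<in> null_sets \<mu>" for n
  proof -
    have "max a (min b (a - real n)) = a" using ab by (auto simp: max_def min_def)
    then show ?thesis using clamp_F[of "a - real n"] by (intro null_setsI) (simp_all add: emeasure_Icc)
  qed
  moreover have "{b..b + real n} \<in> null_sets \<mu>" for n
  proof -
    have "max a (min b (b + real n)) = max a (min b b)" using ab by (auto simp: max_def min_def)
    then show ?thesis using clamp_F[of "b + real n"] clamp_F[of b] by (intro null_setsI) (simp_all add: emeasure_Icc)
  qed
  ultimately have N: "(\<Union>n. {a - real n..a}) \<union> (\<Union>n. {b..b + real n}) \<in> null_sets \<mu>"
    by (intro null_sets.Un null_sets_UN) auto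
  have "UNIV - {a..b} \<subseteq> (\<Union>n. {a - real n..a}) \<union> (\<Union>n. {b..b + real n})"
  proof
    fix x assume "x \<in> UNIV - {a..b}"
    moreover obtain n where "\<bar>x - a\<bar> + \<bar>x - b\<bar> \<le> real n" using real_arch_simple by blast
    ultimately show "x \<in> (\<Union>n. {a - real n..a}) \<union> (\<Union>n. {b..b + real n})"
      by (cases "x < a") (auto intro!: exI[of _ n])
  qed
  then show ?thesis by (intro null_sets_subset[OF N]) auto
qed

lemma finite: "finite_measure \<mu>"
proof
  have "emeasure \<mu> UNIV \<le> emeasure \<mu> ({a..b} \<union> (UNIV - {a..b}))"
    by (rule emeasure_mono) auto
  also have "\<dots> = emeasure \<mu> {a..b}"
    using outside_null by (intro emeasure_Un_null_set) auto
  finally show "emeasure \<mu> (space \<mu>) \<noteq> \<infinity>"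
    using ab by (auto simp: emeasure_Icc top_unique space_interval_measure)
qed

text \<open>
  A null set has a countable cover by non-overlapping intervals of total length below the \<open>\<delta>\<close> that
  absolute continuity provides for \<open>e\<close>. Finitely many of them have total increment below \<open>e\<close>, hence all
  of them have Stieltjes measure at most \<open>e\<close>.
\<close>

lemma null_subset_Icc:
  assumes N: "N \<in> null_sets lborel" "N \<subseteq> {a..b}"
  shows "N \<in> null_sets \<mu>"
proof -
  have "emeasure \<mu> N \<le> ennreal e" if e: "e > 0" for e :: real
  proof -
    obtain \<delta> where \<delta>: "\<delta> > 0" "\<And>(n::nat) l r. (\<forall>i<n. a \<le> l i \<and> l i \<le> r i \<and> r i \<le> b) \<Longrightarrow>
        disjoint_family_on (\<lambda>i. {l i<..<r i}) {..<n} \<Longrightarrow> (\<Sum>i<n. r i - l i) < \<delta> \<Longrightarrow>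
        (\<Sum>i<n. \<bar>F (r i) - F (l i)\<bar>) < e"
      using ac_F e unfolding absolutely_continuous_on_interval_def by meson
    have N_leb: "N \<in> null_sets lebesgue" using N(1) by (rule null_sets_completionI)
    then have N_meas: "N \<in> lmeasurable" "measure lebesgue N = 0"
      by (auto simp: fmeasurable_def null_sets_def measure_def)
    obtain \<D> where D: "countable \<D>"
        "\<And>K. K \<in> \<D> \<Longrightarrow> K \<subseteq> cbox a b \<and> K \<noteq> {} \<and> (\<exists>c d. K = cbox c d)"
        "pairwise (\<lambda>A B. interior A \<inter> interior B = {}) \<D>"
        "N \<subseteq> \<Union>\<D>" "\<Union>\<D> \<in> lmeasurable" "measure lebesgue (\<Union>\<D>) \<le> measure lebesgue N + \<delta> / 2"
      using measurable_outer_intervals_bounded[OF N_meas(1), of a b "\<delta>/2"] N(2) \<delta>(1)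
      by (metis box_real(2) half_gt_zero)
    have fin: "(\<Sum>K\<in>S. emeasure \<mu> K) \<le> ennreal e" if S: "S \<subseteq> \<D>" "finite S" for S
    proof -
      obtain f where f: "bij_betw f {..<card S} S"
        using ex_bij_betw_nat_finite[OF S(2)] atLeast0LessThan by metis
      have fS: "f i \<in> \<D>" if "i < card S" for i
        using f S that by (auto simp: bij_betw_def)
      have "\<forall>i\<in>{..<card S}. \<exists>l r. l \<le> r \<and> f i = {l..r} \<and> a \<le> l \<and> r \<le> b"
      proof
        fix i assume "i \<in> {..<card S}"
        then have "f i \<subseteq> cbox a b" "f i \<noteq> {}" "\<exists>c d. f i = cbox c d" using D(2) fS by auto
        then obtain l r where "f i = {l..r}" "{l..r} \<subseteq> {a..b}" "l \<le> r" by (auto simp: box_real)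
        then show "\<exists>l r. l \<le> r \<and> f i = {l..r} \<and> a \<le> l \<and> r \<le> b" by auto
      qed
      then obtain l r where lr: "\<And>i. i < card S \<Longrightarrow> l i \<le> r i \<and> f i = {l i..r i} \<and> a \<le> l i \<and> r i \<le> b"
        by (metis lessThan_iff)
      have disj: "{l i<..<r i} \<inter> {l j<..<r j} = {}" if "i < card S" "j < card S" "i \<noteq> j" for i j
      proof -
        have "f i \<noteq> f j" using f that by (auto simp: bij_betw_def inj_on_def)
        then have "interior (f i) \<inter> interior (f j) = {}"
          using D(3) fS that by (auto simp: pairwise_def)
        then show ?thesis using lr that by (auto simp: interior_atLeastAtMost_real)
      qed
      have "(\<Sum>i<card S. r i - l i) = (\<Sum>i<card S. measure lebesgue {l i<..<r i})"
        using lr by (intro sum.cong) auto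
      also have "\<dots> = measure lebesgue (\<Union>i<card S. {l i<..<r i})"
        using disj by (intro measure_UNION'[symmetric]) (auto simp: pairwise_def disjnt_def)
      also have "\<dots> \<le> measure lebesgue (\<Union>\<D>)"
      proof (rule measure_mono_fmeasurable)
        show "(\<Union>i<card S. {l i<..<r i}) \<subseteq> \<Union>\<D>"
        proof
          fix x assume "x \<in> (\<Union>i<card S. {l i<..<r i})"
          then obtain i where "i < card S" "x \<in> {l i..r i}" by fastforce
          then show "x \<in> \<Union>\<D>" using lr fS by blast
        qed
      qed (use D in auto)
      also have "\<dots> < \<delta>" using D(6) N_meas \<delta>(1) by simp
      finally have "(\<Sum>i<card S. \<bar>F (r i) - F (l i)\<bar>) < e"
        using lr disj by (intro \<delta>(2)) (auto simp: disjoint_family_on_def)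
      moreover have "(\<Sum>K\<in>S. emeasure \<mu> K) = ennreal (\<Sum>i<card S. \<bar>F (r i) - F (l i)\<bar>)"
      proof -
        have "(\<Sum>K\<in>S. emeasure \<mu> K) = (\<Sum>i<card S. emeasure \<mu> (f i))"
          using sum.reindex_bij_betw[OF f] by metis
        also have "\<dots> = (\<Sum>i<card S. ennreal \<bar>F (r i) - F (l i)\<bar>)"
          using lr mono_F by (intro sum.cong) (auto simp: emeasure_Icc)
        finally show ?thesis by (simp add: sum_ennreal)
      qed
      ultimately show ?thesis by (auto intro: ennreal_leI)
    qed
    have Dm: "K \<in> sets \<mu>" if "K \<in> \<D>" for K using D(2)[OF that] by auto
    have "emeasure \<mu> N \<le> emeasure \<mu> (\<Union>\<D>)"
      using D(1,4) Dm by (intro emeasure_mono sets.countable_Union) auto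
    also have "\<dots> \<le> ennreal e"
    proof (cases "\<D> = {}")
      case False
      define A where "A = (\<lambda>n. \<Union>(from_nat_into \<D> ` {..n}))"
      have UA: "\<Union>\<D> = (\<Union>n. A n)"
      proof -
        have "(\<Union>n. A n) = \<Union>(range (from_nat_into \<D>))" unfolding A_def by blast
        then show ?thesis using range_from_nat_into[OF False D(1)] by simp
      qed
      have sub: "from_nat_into \<D> ` {..n} \<subseteq> \<D>" for n
        using from_nat_into[OF False] by auto
      have "emeasure \<mu> (\<Union>n. A n) = (SUP n. emeasure \<mu> (A n))"
      proof (rule SUP_emeasure_incseq[symmetric])
        have "A n \<in> sets \<mu>" for n
          unfolding A_def using Dm sub by (intro sets.finite_Union) blast+
        then show "range A \<subseteq> sets \<mu>" by blast
        show "incseq A" unfolding incseq_def A_def by (intro allI impI Union_mono image_mono) simp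
      qed
      also have "\<dots> \<le> ennreal e"
      proof (rule SUP_least)
        fix n
        have "emeasure \<mu> (A n) \<le> (\<Sum>K\<in>from_nat_into \<D> ` {..n}. emeasure \<mu> K)"
          unfolding A_def using Dm sub
            emeasure_subadditive_finite[of "from_nat_into \<D> ` {..n}" "\<lambda>K. K" \<mu>] by auto
        also have "\<dots> \<le> ennreal e" by (rule fin) (use sub in auto)
        finally show "emeasure \<mu> (A n) \<le> ennreal e" .
      qed
      finally show ?thesis unfolding UA .
    qed simp
    finally show ?thesis .
  qed
  then have "emeasure \<mu> N \<le> 0" using ennreal_le_epsilon[of 0 "emeasure \<mu> N"] by simp
  then show ?thesis using N(1) by (intro null_setsI) auto
qed

lemma absolutely_continuous_lborel: "absolutely_continuous lborel \<mu>"
  unfolding absolutely_continuous_def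
proof
  fix N assume N: "N \<in> null_sets (lborel :: real measure)"
  have "N \<inter> {a..b} \<in> null_sets \<mu>"
    using N by (intro null_subset_Icc) (auto intro: null_set_Int2)
  then have "(N \<inter> {a..b}) \<union> (UNIV - {a..b}) \<in> null_sets \<mu>"
    using outside_null by blast
  then show "N \<in> null_sets \<mu>"
    using N by (elim null_sets_subset[of "(N \<inter> {a..b}) \<union> (UNIV - {a..b})"]) auto
qed

lemma emeasure_le_of_slow:
  assumes E: "E \<in> sets borel" "E \<subseteq> slow_points F p" and p: "0 \<le> p"
  shows "emeasure \<mu> E \<le> ennreal p * emeasure lborel E"
proof -
  have fine: "\<exists>u v. u < v \<and> x \<in> {u..v} \<and> v - u < d \<and>
      emeasure \<mu> {u..v} \<le> ennreal p * emeasure lborel {u..v}" if xd: "x \<in> E" "0 < d" for x d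
  proof -
    obtain u v where "u < x" "x < v" "v - u < d" "F v - F u < p * (v - u)"
      using slow_pointsD xd E(2) by blast
    then show ?thesis using p by (intro exI[of _ u] exI[of _ v])
      (auto simp: emeasure_Icc ennreal_mult[symmetric] intro!: ennreal_leI)
  qed
  show ?thesis
    by (rule vitali_measure_comparison[OF _ _ absolutely_continuous_lborel
          lborel_outer_open[OF E(1)] E(1) p fine]) simp_all
qed

lemma lborel_le_of_fast:
  assumes E: "E \<in> sets borel" "E \<subseteq> slow_points (\<lambda>x. - F x) (- q)" and q: "0 < q"
  shows "emeasure lborel E \<le> ennreal (1 / q) * emeasure \<mu> E"
proof -
  have fine: "\<exists>u v. u < v \<and> x \<in> {u..v} \<and> v - u < d \<and>
      emeasure lborel {u..v} \<le> ennreal (1 / q) * emeasure \<mu> {u..v}" if xd: "x \<in> E" "0 < d" for x d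
  proof -
    obtain u v where "u < x" "x < v" "v - u < d" "- F v - - F u < - q * (v - u)"
      using slow_pointsD xd E(2) by blast
    then show ?thesis using q mono_F[of u v] by (intro exI[of _ u] exI[of _ v])
      (auto simp: emeasure_Icc ennreal_mult[symmetric] field_simps intro!: ennreal_leI)
  qed
  have ac: "absolutely_continuous lborel lborel" by (simp add: absolutely_continuous_def)
  have "0 \<le> 1 / q" using q by simp
  show ?thesis
    by (rule vitali_measure_comparison[OF _ _ ac
          finite_measure_outer_open[OF _ finite E(1)] E(1) \<open>0 \<le> 1 / q\<close> fine]) simp_all
qed

text \<open>
  On this set \<open>E\<close> the comparison works in both directions, \<open>q |E| \<le> \<mu> E \<le> p |E|\<close>, and all these
  quantities are finite.
\<close>

lemma slow_fast_null:
  assumes "0 < p" "p < q"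
  shows "slow_points F p \<inter> slow_points (\<lambda>x. - F x) (- q) \<in> null_sets lborel" (is "?E \<in> _")
proof -
  have E: "?E \<in> sets borel" by (intro sets.Int slow_points_borel)
  have 1: "emeasure \<mu> ?E \<le> ennreal p * emeasure lborel ?E"
    using assms by (intro emeasure_le_of_slow E) auto
  have 2: "emeasure lborel ?E \<le> ennreal (1 / q) * emeasure \<mu> ?E"
    using assms by (intro lborel_le_of_fast E) auto
  obtain m where m: "emeasure \<mu> ?E = ennreal m" "0 \<le> m"
    using finite_measure.emeasure_finite[OF finite, of ?E]
    by (cases "emeasure \<mu> ?E" rule: ennreal_cases) auto
  with 2 have "emeasure lborel ?E < \<infinity>"
    using assms by (auto simp: ennreal_mult[symmetric] less_top[symmetric] top_unique)
  then obtain l where l: "emeasure lborel ?E = ennreal l" "0 \<le> l"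
    by (cases "emeasure lborel ?E" rule: ennreal_cases) auto
  have "m \<le> p * l" "l \<le> m / q"
    using 1 2 m l assms by (auto simp: ennreal_mult[symmetric])
  then have "q * l \<le> p * l" using assms by (simp add: field_simps)
  then have "l * (q - p) \<le> 0" by (simp add: algebra_simps)
  with assms l have "l = 0" by (simp add: mult_le_0_iff)
  with l E show ?thesis by (intro null_setsI) auto
qed

text \<open>
  These are the points where the upper derivative is infinite: \<open>n |E| \<le> \<mu> E < \<infinity>\<close> for all \<open>n\<close>.
\<close>

lemma everywhere_fast_null: "(\<Inter>n. slow_points (\<lambda>x. - F x) (- real (Suc n))) \<in> null_sets lborel"
proof -
  define E where "E = (\<Inter>n. slow_points (\<lambda>x. - F x) (- real (Suc n)))"
  have E: "E \<in> sets borel"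
    unfolding E_def by (rule sets.countable_INT'') (simp_all add: slow_points_borel)
  obtain m where m: "emeasure \<mu> E = ennreal m" "0 \<le> m"
    using finite_measure.emeasure_finite[OF finite, of E]
    by (cases "emeasure \<mu> E" rule: ennreal_cases) auto
  have le: "emeasure lborel E \<le> ennreal (m / real (Suc n))" for n
  proof -
    have sub: "E \<subseteq> slow_points (\<lambda>x. - F x) (- real (Suc n))" unfolding E_def by blast
    have "emeasure lborel E \<le> ennreal (1 / real (Suc n)) * emeasure \<mu> E"
      by (rule lborel_le_of_fast[OF E sub]) simp
    also have "\<dots> = ennreal (1 / real (Suc n) * m)"
      unfolding m(1) by (rule ennreal_mult[symmetric]) (use m(2) in simp_all)
    finally show ?thesis by simp
  qed
  have lim: "(\<lambda>n. ennreal (m / real (Suc n))) \<longlonglongrightarrow> ennreal 0"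
    by (intro tendsto_ennrealI LIMSEQ_Suc) (rule lim_const_over_n)
  have "emeasure lborel E \<le> ennreal 0"
    by (rule LIMSEQ_le_const[OF lim]) (use le in blast)
  then show ?thesis using E unfolding E_def by (simp add: null_sets_def)
qed

text \<open>
  Outside the countably many null sets \<open>slow p \<inter> fast q\<close> with rational \<open>p < q\<close>, the lower and upper
  limits of the difference quotient at \<open>x\<close> cannot be separated by rationals, so they agree; outside the
  set above they are finite.
\<close>

lemma AE_has_derivative: "AE x in lborel. \<exists>D. (F has_real_derivative D) (at x)"
proof -
  have "AE x in lborel. \<forall>p::rat. \<forall>q::rat. 0 < p \<and> p < q \<longrightarrow>
      x \<notin> slow_points F (of_rat p) \<inter> slow_points (\<lambda>x. - F x) (- of_rat q)"
    unfolding AE_all_countable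
    by (intro allI AE_impI AE_not_in slow_fast_null) (auto simp: of_rat_less)
  moreover have "AE x in lborel. x \<notin> (\<Inter>n. slow_points (\<lambda>x. - F x) (- real (Suc n)))"
    by (rule AE_not_in[OF everywhere_fast_null])
  ultimately show ?thesis
  proof eventually_elim
    fix x
    assume pq: "\<forall>p::rat. \<forall>q::rat. 0 < p \<and> p < q \<longrightarrow>
        x \<notin> slow_points F (of_rat p) \<inter> slow_points (\<lambda>x. - F x) (- of_rat q)"
      and "x \<notin> (\<Inter>n. slow_points (\<lambda>x. - F x) (- real (Suc n)))"
    then obtain n where n: "x \<notin> slow_points (\<lambda>x. - F x) (- real (Suc n))" by auto
    define f where "f = (\<lambda>y. (F y - F x) / (y - x))"
    have not_slow: "\<forall>\<^sub>F y in at x. p \<le> f y" if "x \<notin> slow_points F p" for p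
      using frequently_slope_less_imp_slow[OF cont_F, of x p] that
      by (auto simp: frequently_def f_def not_less)
    have not_fast: "\<forall>\<^sub>F y in at x. f y \<le> q" if "x \<notin> slow_points (\<lambda>x. - F x) (- q)" for q
    proof -
      have neg: "(- F y - - F x) / (y - x) = - ((F y - F x) / (y - x))" for y
        by (simp add: minus_divide_left)
      have "\<not> (\<exists>\<^sub>F y in at x. (- F y - - F x) / (y - x) < - q)"
        using frequently_slope_less_imp_slow[of "\<lambda>x. - F x" x "- q"] cont_F that continuous_on_minus
        by blast
      then show ?thesis unfolding neg by (simp add: not_frequently f_def not_less)
    qed
    \<comment> \<open>The supremum of \<open>A\<close> is the lower limit of the difference quotient.\<close>
    define A where "A = {p. \<forall>\<^sub>F y in at x. p \<le> f y}"
    have "0 \<in> A"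
      using mono_F[of x] mono_F[of _ x] unfolding A_def f_def
      by (auto intro!: always_eventually simp: zero_le_divide_iff) (meson linear)+
    have upper: "p \<le> real (Suc n)" if "p \<in> A" for p
    proof -
      have "\<forall>\<^sub>F y in at x. p \<le> f y \<and> f y \<le> real (Suc n)"
        using that not_fast[OF n] by (auto simp: A_def eventually_conj)
      then show ?thesis
        by (metis (mono_tags, lifting) eventually_happens' at_neq_bot order_trans)
    qed
    then have bdd: "bdd_above A" by (auto simp: bdd_above_def)
    have "Sup A \<ge> 0" using \<open>0 \<in> A\<close> bdd by (rule cSup_upper)
    have "(f \<longlongrightarrow> Sup A) (at x)"
    proof (rule order_tendstoI)
      fix c assume "c < Sup A"
      then obtain p where "p \<in> A" "c < p" using \<open>0 \<in> A\<close> bdd by (metis empty_iff less_cSup_iff)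
      then show "\<forall>\<^sub>F y in at x. c < f y" by (auto simp: A_def elim: eventually_mono)
    next
      fix c assume c: "Sup A < c"
      obtain p where p: "Sup A < of_rat p" "of_rat p < c" using of_rat_dense[OF c] by blast
      obtain q where q: "real_of_rat p < of_rat q" "of_rat q < c" using of_rat_dense[OF p(2)] by blast
      have "of_rat p \<notin> A" using cSup_upper[OF _ bdd, of "of_rat p"] p(1) by linarith
      then have "x \<in> slow_points F (of_rat p)" using not_slow by (auto simp: A_def)
      moreover have "0 < real_of_rat p" using p \<open>Sup A \<ge> 0\<close> by linarith
      then have "0 < p" by simp
      moreover have "p < q" using q(1) by (simp add: of_rat_less)
      ultimately have "x \<notin> slow_points (\<lambda>x. - F x) (- of_rat q)" using pq by blast
      from not_fast[OF this] show "\<forall>\<^sub>F y in at x. f y < c" by (rule eventually_mono) (use q(2) in linarith)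
    qed
    then show "\<exists>D. (F has_real_derivative D) (at x)"
      by (auto simp: has_field_derivative_iff f_def)
  qed
qed

text \<open>
  Almost every point of the interval is slow for the slope \<open>c + e\<close>; the remaining points are null for
  Lebesgue measure and therefore for the Stieltjes measure, so the comparison applies to the interval.
\<close>

lemma increment_le_of_derivative_le:
  assumes uv: "u \<le> v" and c: "0 \<le> c"
    and AE: "AE x in lborel. u < x \<and> x < v \<longrightarrow> (\<forall>D. (F has_real_derivative D) (at x) \<longrightarrow> D \<le> c)"
  shows "F v - F u \<le> c * (v - u)"
proof -
  have "F v - F u \<le> (c + e) * (v - u)" if e: "0 < e" for e
  proof -
    define E where "E = slow_points F (c + e) \<inter> {u..v}"
    have E: "E \<in> sets borel" unfolding E_def by (intro sets.Int slow_points_borel) auto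
    have "AE x in lborel. x \<notin> {u, v}"
      by (intro AE_not_in null_setsI) (auto intro: emeasure_lborel_countable)
    with AE AE_has_derivative have "AE x in lborel. x \<in> {u..v} \<longrightarrow> x \<in> E"
    proof eventually_elim
      case (elim x)
      show ?case
      proof
        assume x: "x \<in> {u..v}"
        then obtain D where D: "(F has_real_derivative D) (at x)" "D \<le> c" using elim by force
        then have "\<forall>\<^sub>F y in at x. (F y - F x) / (y - x) < c + e"
          using e by (auto simp: has_field_derivative_iff order_tendsto_iff)
        then have "x \<in> slow_points F (c + e)"
          by (intro frequently_slope_less_imp_slow cont_F eventually_frequently) auto
        then show "x \<in> E" using x by (simp add: E_def)
      qed
    qed
    then have "{u..v} - E \<in> null_sets lborel"
      using E by (subst AE_iff_null_sets) (auto elim: eventually_mono)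
    then have null: "{u..v} - E \<in> null_sets \<mu>"
      using absolutely_continuous_lborel by (auto simp: absolutely_continuous_def)
    have "emeasure \<mu> {u..v} \<le> emeasure \<mu> (E \<union> ({u..v} - E))"
      using E by (intro emeasure_mono) auto
    also have "\<dots> = emeasure \<mu> E" using null E by (intro emeasure_Un_null_set) auto
    also have "\<dots> \<le> ennreal (c + e) * emeasure lborel E"
      using c e E by (intro emeasure_le_of_slow) (auto simp: E_def)
    also have "\<dots> \<le> ennreal (c + e) * emeasure lborel {u..v}"
      using E by (intro mult_left_mono emeasure_mono) (auto simp: E_def)
    also have "\<dots> = ennreal ((c + e) * (v - u))"
      using uv c e by (simp add: ennreal_mult del: ennreal_plus)
    finally show ?thesis
      using uv c e by (simp add: emeasure_Icc)
  qed
  then have "(F v - F u) \<le> c * (v - u) + e * (v - u)" if "0 < e" for e :: real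
    using that by (simp add: distrib_right)
  moreover have "((\<lambda>e. c * (v - u) + e * (v - u)) \<longlongrightarrow> c * (v - u) + 0 * (v - u)) (at_right 0)"
    by (intro tendsto_intros)
  ultimately show ?thesis
    by (intro tendsto_lowerbound[where F="at_right 0" and f="\<lambda>e. c * (v - u) + e * (v - u)"])
      (auto simp: eventually_at_right_less intro: eventually_mono[OF eventually_at_right_less])
qed

end

section \<open>The law of the transformed variable\<close>

lemma absolutely_continuous_imp_continuous_on:
  assumes "absolutely_continuous_on_interval c d f"
  shows "continuous_on {c..d} f"
  unfolding continuous_on_iff
proof (intro ballI allI impI)
  fix x e :: real assume x: "x \<in> {c..d}" and e: "0 < e"
  obtain \<delta> where \<delta>: "\<delta> > 0" "\<And>(n::nat) l r. (\<forall>i<n. c \<le> l i \<and> l i \<le> r i \<and> r i \<le> d) \<Longrightarrow>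
        disjoint_family_on (\<lambda>i. {l i<..<r i}) {..<n} \<Longrightarrow> (\<Sum>i<n. r i - l i) < \<delta> \<Longrightarrow>
        (\<Sum>i<n. \<bar>f (r i) - f (l i)\<bar>) < e"
    using assms e unfolding absolutely_continuous_on_interval_def by meson
  have "dist (f y) (f x) < e" if "y \<in> {c..d}" "dist y x < \<delta>" for y
    using \<delta>(2)[of 1 "\<lambda>_. min x y" "\<lambda>_. max x y"] x that
    by (cases "x \<le> y") (auto simp: dist_real_def disjoint_family_on_def)
  then show "\<exists>\<delta>>0. \<forall>y\<in>{c..d}. dist y x < \<delta> \<longrightarrow> dist (f y) (f x) < e"
    using \<delta>(1) by blast
qed

abbreviation uniform01 :: "real measure" where
  "uniform01 \<equiv> uniform_measure lborel {0..1}"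

lemma prob_space_uniform01: "prob_space uniform01"
  by (rule prob_space_uniform_measure) simp_all

lemma AE_uniform01: "(\<And>u. 0 \<le> u \<Longrightarrow> u \<le> 1 \<Longrightarrow> P u) \<Longrightarrow> AE u in uniform01. P u"
  by (rule AE_uniform_measureI) auto

lemma powr_less_cancel_left:
  fixes a b p :: real
  assumes "0 \<le> a" "0 \<le> b" "0 < p"
  shows "a powr p < b powr p \<longleftrightarrow> a < b"
  using assms powr_less_mono2[of p a b] powr_mono2[of p b a] by linarith

locale dickman_utility =
  fixes \<theta> :: real and s :: "real \<Rightarrow> real"
  assumes theta_pos: "0 < \<theta>" and utility: "utility_function s"
begin

lemma s_nonneg: "0 \<le> x \<Longrightarrow> 0 \<le> s x"
  and s_zero: "s 0 = 0"
  and s_less: "0 \<le> x \<Longrightarrow> x < y \<Longrightarrow> s x < s y"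
  and s_ac: "0 \<le> c \<Longrightarrow> c \<le> d \<Longrightarrow> absolutely_continuous_on_interval c d s"
  using utility unfolding utility_function_def strict_mono_on_def by auto

lemma s_le: "0 \<le> x \<Longrightarrow> x \<le> y \<Longrightarrow> s x \<le> s y"
  using s_less[of x y] by (cases "x = y") auto

lemma s_le_iff: "0 \<le> x \<Longrightarrow> 0 \<le> y \<Longrightarrow> s x \<le> s y \<longleftrightarrow> x \<le> y"
  using s_le[of x y] s_less[of y x] by linarith

lemma s_less_iff: "0 \<le> x \<Longrightarrow> 0 \<le> y \<Longrightarrow> s x < s y \<longleftrightarrow> x < y"
  using s_le_iff[of y x] by linarith

lemma s_pos: "0 < x \<Longrightarrow> 0 < s x"
  using s_less[of 0 x] s_zero by simp

lemma inj_s: "inj_on s {0..}"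
  by (rule inj_onI) (metis atLeast_iff less_irrefl linorder_neqE_linordered_idom s_less)

lemma continuous_s_Icc: "continuous_on {0..b} s"
proof (cases "0 \<le> b")
  case True
  then show ?thesis by (intro absolutely_continuous_imp_continuous_on s_ac) auto
qed simp

lemma continuous_s: "continuous_on {0..} s"
  unfolding continuous_on_eq_continuous_within
proof
  fix x :: real assume x: "x \<in> {0..}"
  have "at x within {0..} = at x within {0..x+1}"
    by (rule at_within_nhd[where S="{..<x+1}"]) auto
  moreover have "continuous (at x within {0..x+1}) s"
    using continuous_s_Icc[of "x+1"] x by (auto simp: continuous_on_eq_continuous_within)
  ultimately show "continuous (at x within {0..}) s"
    by (simp add: continuous_within)
qed

lemma isCont_s: "0 < x \<Longrightarrow> isCont s x"
  using continuous_on_interior[OF continuous_s, of x] by simp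

definition \<sigma> :: "real \<Rightarrow> real" where "\<sigma> = the_inv_into {0..} s"

lemma sigma_s: "0 \<le> x \<Longrightarrow> \<sigma> (s x) = x"
  unfolding \<sigma>_def by (intro the_inv_into_f_f inj_s) simp

lemma preimage_s:
  assumes "0 \<le> r" "r \<le> s x" "0 \<le> x"
  obtains y where "0 \<le> y" "y \<le> x" "s y = r"
  using IVT'[of s 0 r x] assms continuous_s_Icc[of x] s_zero by auto

text \<open>
  The image of \<open>s\<close> need not be all of \<open>{0..}\<close>, as \<open>s\<close> may be bounded. Outside the image the
  inverse is one fixed unspecified value; on the image it is monotone.
\<close>

lemma sigma_measurable [measurable]: "\<sigma> \<in> borel_measurable borel"
proof -
  let ?J = "s ` {0..}"
  have "?J = (\<Union>n. {0..s (real n)})"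
  proof (intro equalityI subsetI)
    fix t assume "t \<in> ?J"
    then obtain x where x: "0 \<le> x" "t = s x" by auto
    obtain n where "x \<le> real n" using real_arch_simple by blast
    then show "t \<in> (\<Union>n. {0..s (real n)})" using x s_nonneg s_le by auto
  next
    fix t assume "t \<in> (\<Union>n. {0..s (real n)})"
    then obtain n where "0 \<le> t" "t \<le> s (real n)" by auto
    then show "t \<in> ?J" by (rule preimage_s) auto
  qed
  then have J: "?J \<in> sets borel" by simp
  have "mono_on ?J \<sigma>"
  proof (rule mono_onI)
    fix a b assume ab: "a \<in> ?J" "b \<in> ?J" "a \<le> b"
    then obtain x y where "0 \<le> x" "0 \<le> y" "a = s x" "b = s y" by auto
    with ab show "\<sigma> a \<le> \<sigma> b" by (simp add: sigma_s s_le_iff)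
  qed
  then have "\<sigma> \<in> borel_measurable (restrict_space borel ?J)"
    by (rule borel_measurable_mono_on_fnc)
  then have "(\<lambda>t. if t \<in> ?J then \<sigma> t else (THE y::real. False)) \<in> borel_measurable borel"
    using J by (subst (asm) measurable_restrict_space_iff) auto
  moreover have "(if t \<in> ?J then \<sigma> t else (THE y::real. False)) = \<sigma> t" for t
  proof (cases "t \<in> ?J")
    case False
    then have "(\<lambda>y. y \<in> {0..} \<and> s y = t) = (\<lambda>y. False)" by auto
    with False show ?thesis by (simp add: \<sigma>_def the_inv_into_def)
  qed simp
  ultimately show ?thesis by simp
qed

text \<open>
  Applied to \<open>x = W + 1\<close> and a uniform \<open>u\<close>, this is the random variable \<open>W\<^sup>*\<close>.
\<close>

definition q :: "real \<Rightarrow> real \<Rightarrow> real" where "q x u = \<sigma> (u powr (1 / \<theta>) * s x)"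

lemma q_properties:
  assumes "0 \<le> x" "0 \<le> u" "u \<le> 1"
  shows q_nonneg: "0 \<le> q x u" and q_le: "q x u \<le> x" and s_q: "s (q x u) = u powr (1 / \<theta>) * s x"
proof -
  have u: "0 \<le> u powr (1 / \<theta>)" "u powr (1 / \<theta>) \<le> 1"
    using assms theta_pos powr_mono2[of "1/\<theta>" u 1] by auto
  have "0 \<le> u powr (1 / \<theta>) * s x" "u powr (1 / \<theta>) * s x \<le> s x"
    using u s_nonneg[OF assms(1)] by (auto simp: mult_left_le_one_le)
  then obtain y where "0 \<le> y" "y \<le> x" "s y = u powr (1 / \<theta>) * s x"
    using assms(1) by (rule preimage_s)
  moreover have "q x u = y" using calculation sigma_s[of y] by (simp add: q_def)
  ultimately show "0 \<le> q x u" "q x u \<le> x" "s (q x u) = u powr (1 / \<theta>) * s x" by auto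
qed

lemma q_mono:
  assumes "0 \<le> x" "x \<le> y" "0 \<le> u" "u \<le> 1"
  shows "q x u \<le> q y u"
proof -
  have "s (q x u) \<le> s (q y u)"
    using assms s_q[of x u] s_q[of y u] s_le[of x y] by (auto intro: mult_left_mono)
  then show ?thesis using assms by (simp add: s_le_iff q_nonneg)
qed

lemma q_measurable [measurable]: "q x \<in> borel_measurable borel"
  unfolding q_def by measurable

lemma q_integrable: "0 \<le> x \<Longrightarrow> integrable uniform01 (q x)"
proof -
  assume x: "0 \<le> x"
  interpret prob_space uniform01 by (rule prob_space_uniform01)
  show ?thesis
    by (rule integrable_const_bound[where B=x]) (auto intro!: AE_uniform01 simp: q_nonneg q_le x)
qed

definition J :: "real \<Rightarrow> real" where "J x = integral {0..x} (\<lambda>v. s v powr \<theta>)"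

text \<open>
  The function \<open>I\<close> without the factor \<open>s'\<close>; unlike \<open>I\<close> it is continuous on \<open>{0<..}\<close>.
\<close>

definition K :: "real \<Rightarrow> real" where "K x = \<theta> * J x / s x powr (\<theta> + 1)"

lemma continuous_s_powr: "continuous_on {0..} (\<lambda>v. s v powr \<theta>)"
  using theta_pos s_nonneg by (intro continuous_on_powr' continuous_s continuous_on_const) auto

lemma s_powr_integrable: "0 \<le> a \<Longrightarrow> (\<lambda>v. s v powr \<theta>) integrable_on {a..b}"
  by (intro integrable_continuous_real continuous_on_subset[OF continuous_s_powr]) auto

lemma J_nonneg: "0 \<le> J x"
  unfolding J_def by (intro integral_nonneg s_powr_integrable) auto

lemma J_increment:
  assumes "0 \<le> x" "x \<le> y"
  shows "s x powr \<theta> * (y - x) \<le> J y - J x"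
proof -
  have "J x + integral {x..y} (\<lambda>v. s v powr \<theta>) = J y"
    unfolding J_def using assms by (intro Henstock_Kurzweil_Integration.integral_combine s_powr_integrable) auto
  moreover have "integral {x..y} (\<lambda>v. s x powr \<theta>) \<le> integral {x..y} (\<lambda>v. s v powr \<theta>)"
    using assms theta_pos s_le s_nonneg
    by (intro integral_le s_powr_integrable integrable_const_ivl powr_mono2) auto
  ultimately show ?thesis using assms by (simp add: mult.commute)
qed

lemma J_pos:
  assumes "0 < x" shows "0 < J x"
proof -
  have "0 < s (x/2) powr \<theta> * (x - x/2)" using assms s_pos[of "x/2"] by auto
  also have "\<dots> \<le> J x - J (x/2)" using assms by (intro J_increment) auto
  finally show ?thesis using J_nonneg[of "x/2"] by linarith
qed

lemma isCont_J: assumes "0 < x" shows "isCont J x"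
proof -
  have "continuous_on {0..x+1} J"
    unfolding J_def by (intro indefinite_integral_continuous_1 s_powr_integrable) auto
  then show ?thesis using assms by (intro continuous_on_interior[of "{0..x+1}"]) auto
qed

lemma K_pos: "0 < x \<Longrightarrow> 0 < K x"
  using theta_pos J_pos[of x] s_pos[of x] by (auto simp: K_def)

lemma isCont_K: assumes "0 < x" shows "isCont K x"
  unfolding K_def using assms s_pos[OF assms]
  by (intro continuous_intros isCont_J isCont_s) auto

text \<open>
  The layer-cake formula: by Fubini the mean is the area of the region \<open>0 \<le> v < q x u\<close>. For fixed
  \<open>v \<le> x\<close> the condition means \<open>u > (s v / s x)\<^sup>\<theta>\<close>, so its section has length \<open>1 - (s v / s x)\<^sup>\<theta>\<close>.
\<close>

lemma mean_q:
  assumes x: "0 < x"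
  shows "(\<integral>u. q x u \<partial>uniform01) = x - J x / s x powr \<theta>"
proof -
  let ?r = "\<lambda>v. (s v / s x) powr \<theta>"
  have sx: "0 < s x" using x by (rule s_pos)
  let ?f = "\<lambda>u v. indicator {0..1} u * indicator {0..<q x u} v :: ennreal"
  have cont_r: "continuous_on {0..x} ?r"
    using sx s_nonneg theta_pos
    by (intro continuous_on_powr' continuous_intros continuous_on_subset[OF continuous_s]) auto
  have r_eq: "?r v = s v powr \<theta> / s x powr \<theta>" if "0 \<le> v" for v
    using that s_nonneg sx by (simp add: powr_divide)
  have r_le: "?r v \<le> 1" if "0 \<le> v" "v \<le> x" for v
    using that sx s_nonneg[of v] s_le[of v x] theta_pos powr_mono2[of \<theta> "s v / s x" 1] by auto
  have int_r: "((\<lambda>v. 1 - ?r v) has_integral (x - J x / s x powr \<theta>)) {0..x}"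
  proof -
    have "((\<lambda>v. s v powr \<theta>) has_integral J x) {0..x}"
      unfolding J_def by (intro integrable_integral s_powr_integrable) auto
    then have "((\<lambda>v. s v powr \<theta> / s x powr \<theta>) has_integral (J x / s x powr \<theta>)) {0..x}"
      by (rule has_integral_divide)
    then have "(?r has_integral (J x / s x powr \<theta>)) {0..x}"
      by (rule has_integral_eq[rotated]) (simp add: r_eq)
    moreover have "((\<lambda>v. 1::real) has_integral x) {0..x}"
      using has_integral_const_real[of "1::real" 0 x] x by simp
    ultimately show ?thesis by (rule has_integral_diff[rotated])
  qed
  have inner: "(\<integral>\<^sup>+u. ?f u v \<partial>lborel) = ennreal (indicator {0..x} v * (1 - ?r v))" for v
  proof (cases "0 \<le> v \<and> v \<le> x")
    case True
    have "v < q x u \<longleftrightarrow> ?r v < u" if u: "0 \<le> u" "u \<le> 1" for u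
    proof -
      have "v < q x u \<longleftrightarrow> s v < u powr (1 / \<theta>) * s x"
        using True u x s_q[of x u] s_less_iff[of v "q x u"] q_nonneg[of x u] by simp
      also have "\<dots> \<longleftrightarrow> s v / s x < u powr (1 / \<theta>)" using sx by (simp add: field_simps)
      also have "\<dots> \<longleftrightarrow> ?r v < (u powr (1 / \<theta>)) powr \<theta>"
        using True sx s_nonneg[of v] theta_pos by (intro powr_less_cancel_left[symmetric]) auto
      also have "(u powr (1 / \<theta>)) powr \<theta> = u" using u theta_pos by (simp add: powr_powr)
      finally show ?thesis .
    qed
    moreover have r_nonneg: "0 \<le> ?r v" by simp
    ultimately have "?f u v = indicator {?r v<..1} u" for u
      using True by (cases "0 \<le> u \<and> u \<le> 1") (auto simp: indicator_def dest: order.strict_trans1[OF r_nonneg])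
    then have "(\<integral>\<^sup>+u. ?f u v \<partial>lborel) = emeasure lborel {?r v<..1}" by simp
    then show ?thesis using True r_le[of v] by simp
  next
    case False
    then have zero: "?f u v = 0" for u
      using q_le[of x u] x by (auto simp: indicator_def)
    show ?thesis unfolding zero using False by simp
  qed
  have "(\<integral>\<^sup>+u. ennreal (q x u) \<partial>uniform01) = (\<integral>\<^sup>+u. ennreal (q x u) * indicator {0..1} u \<partial>lborel)"
    by (subst nn_integral_uniform_measure) (simp_all add: divide_ennreal_def)
  also have "\<dots> = (\<integral>\<^sup>+u. (\<integral>\<^sup>+v. ?f u v \<partial>lborel) \<partial>lborel)"
  proof (rule nn_integral_cong)
    fix u :: real
    show "ennreal (q x u) * indicator {0..1} u = (\<integral>\<^sup>+v. ?f u v \<partial>lborel)"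
      using q_nonneg[of x u] x by (cases "u \<in> {0..1}") (auto simp: indicator_def[of "{0..1}"])
  qed
  also have "\<dots> = (\<integral>\<^sup>+v. (\<integral>\<^sup>+u. ?f u v \<partial>lborel) \<partial>lborel)"
    by (rule lborel_pair.Fubini'[symmetric]) (simp add: indicator_def)
  also have "\<dots> = (\<integral>\<^sup>+v. ennreal (indicator {0..x} v * (1 - ?r v)) \<partial>lborel)"
    by (simp only: inner)
  also have "\<dots> = ennreal (x - J x / s x powr \<theta>)"
  proof (rule nn_integral_has_integral_lborel)
    show "(\<lambda>v. indicator {0..x} v * (1 - ?r v)) \<in> borel_measurable borel"
      using borel_measurable_continuous_on_indicator[of "{0..x}" "\<lambda>v. 1 - ?r v"]
        continuous_on_diff[OF continuous_on_const cont_r] by simp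
    show "0 \<le> indicator {0..x} v * (1 - ?r v)" for v using r_le[of v] by (auto simp: indicator_def)
    have "(\<lambda>v. indicator {0..x} v * (1 - ?r v)) = (\<lambda>v. if v \<in> {0..x} then 1 - ?r v else 0)"
      by (auto simp: indicator_def)
    then show "((\<lambda>v. indicator {0..x} v * (1 - ?r v)) has_integral (x - J x / s x powr \<theta>)) UNIV"
      using int_r by (simp only: has_integral_restrict_UNIV)
  qed
  finally have "(\<integral>\<^sup>+u. ennreal (q x u) \<partial>uniform01) = ennreal (x - J x / s x powr \<theta>)" .
  moreover have "0 \<le> x - J x / s x powr \<theta>"
    using int_r r_le by (intro has_integral_nonneg[OF int_r]) auto
  ultimately show ?thesis
    using x by (subst integral_eq_nn_integral) (auto intro!: AE_uniform01 simp: q_nonneg)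
qed

end

section \<open>Lipschitz bounds\<close>

lemma abs_lipschitz:
  assumes "1-lipschitz_on UNIV (h :: real \<Rightarrow> real)"
  shows "\<bar>h x - h y\<bar> \<le> \<bar>x - y\<bar>"
  using lipschitz_onD[OF assms, of x y] by (simp add: dist_real_def)

lemma lipschitz_measurable:
  assumes "1-lipschitz_on UNIV (h :: real \<Rightarrow> real)"
  shows "h \<in> borel_measurable borel"
  using assms by (intro borel_measurable_continuous_onI lipschitz_on_continuous_on)

context dickman_utility
begin

text \<open>
  With \<open>A = s(x)\<^sup>\<theta>\<close> and \<open>B = s(y)\<^sup>\<theta>\<close>, the difference of the two means is
  \<open>(y - x) - (J y - J x) / B + J x (1/A - 1/B)\<close>. The bound \<open>J y - J x \<ge> A (y - x)\<close> yields the first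
  term, which is \<open>o(y - x)\<close> as \<open>y \<rightarrow> x\<close>, and Bernoulli's inequality
  \<open>1 - t\<^bsup>-\<theta>\<^esup> \<le> \<theta> (t - 1)\<close> for \<open>t = s y / s x\<close> yields the second.
\<close>

lemma mean_q_increment:
  assumes xy: "0 < x" "x \<le> y"
  shows "(\<integral>u. q y u \<partial>uniform01) - (\<integral>u. q x u \<partial>uniform01)
    \<le> (1 - s x powr \<theta> / s y powr \<theta>) * (y - x) + K x * (s y - s x)"
proof -
  define A where "A = s x powr \<theta>"
  define B where "B = s y powr \<theta>"
  have sp: "0 < s x" "0 < s y" "s x \<le> s y" using xy s_pos s_le[of x y] by auto
  have AB: "0 < A" "0 < B" "A / B = (s x / s y) powr \<theta>"
    using sp by (auto simp: A_def B_def powr_divide)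
  have "1 - \<theta> * (s y / s x - 1) \<le> 1 - \<theta> * ln (s y / s x)"
    using sp theta_pos ln_le_minus_one[of "s y / s x"] by (auto intro: mult_left_mono)
  also have "\<dots> \<le> exp (- \<theta> * ln (s y / s x))"
    using exp_ge_add_one_self[of "- \<theta> * ln (s y / s x)"] by simp
  also have "- \<theta> * ln (s y / s x) = \<theta> * ln (s x / s y)"
    using sp by (simp add: ln_div right_diff_distrib)
  also have "exp \<dots> = A / B"
    using sp AB by (simp add: powr_def)
  finally have bern: "1 - A / B \<le> \<theta> * (s y - s x) / s x"
    using sp by (simp add: field_simps)
  have "J x * (1 / A - 1 / B) = J x / A * (1 - A / B)"
    using AB(1,2) by (simp add: field_simps)
  also have "\<dots> \<le> J x / A * (\<theta> * (s y - s x) / s x)"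
    using AB J_nonneg[of x] bern by (intro mult_left_mono) auto
  also have "\<dots> = K x * (s y - s x)"
    using sp by (simp add: K_def A_def powr_add)
  finally have 1: "J x * (1 / A - 1 / B) \<le> K x * (s y - s x)" .
  have "(J x + A * (y - x)) / B \<le> J y / B"
    using AB J_increment[of x y] xy by (intro divide_right_mono) (auto simp: A_def)
  then have "(y - J y / B) - (x - J x / A) \<le> (1 - A / B) * (y - x) + J x * (1 / A - 1 / B)"
    by (simp add: algebra_simps add_divide_distrib diff_divide_distrib)
  with 1 show ?thesis
    using xy mean_q[of x] mean_q[of y] by (simp add: A_def B_def)
qed

text \<open>
  The function \<open>s\<close> is made constant outside \<open>{0..v}\<close> without changing it, or its derivative, inside.
  At points where \<open>s\<close> has no derivative, \<open>deriv s x\<close> is arbitrary; almost everywhere differentiability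
  is what turns the hypothesis into a bound on slopes.
\<close>

lemma s_increment_le:
  assumes uv: "0 < u" "u \<le> v" and c: "0 \<le> c"
    and AE: "AE x in lborel. u < x \<and> x < v \<longrightarrow> deriv s x \<le> c"
  shows "s v - s u \<le> c * (v - u)"
proof -
  define F where "F = (\<lambda>x. s (max 0 (min v x)))"
  have F_eq: "F x = s x" if "0 \<le> x" "x \<le> v" for x
    using that by (simp add: F_def)
  interpret F: ac_distribution_function F 0 v
  proof
    show "0 \<le> v" using uv by simp
    show "F x \<le> F y" if "x \<le> y" for x y
      unfolding F_def using that by (intro s_le) auto
    show "continuous_on UNIV F"
      unfolding F_def by (rule continuous_on_compose2[OF continuous_s]) (auto intro!: continuous_intros)
    show "F x = F (max 0 (min v x))" for x using uv by (simp add: F_def)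
    show "absolutely_continuous_on_interval 0 v F"
      unfolding absolutely_continuous_on_interval_def
    proof (intro allI impI)
      fix e :: real assume e: "0 < e"
      have "absolutely_continuous_on_interval 0 v s" using uv by (intro s_ac) auto
      with e obtain \<delta> where \<delta>: "\<delta> > 0" "\<And>(n::nat) l r. (\<forall>i<n. 0 \<le> l i \<and> l i \<le> r i \<and> r i \<le> v) \<Longrightarrow>
        disjoint_family_on (\<lambda>i. {l i<..<r i}) {..<n} \<Longrightarrow> (\<Sum>i<n. r i - l i) < \<delta> \<Longrightarrow>
        (\<Sum>i<n. \<bar>s (r i) - s (l i)\<bar>) < e"
        unfolding absolutely_continuous_on_interval_def by meson
      have "(\<Sum>i<n. \<bar>F (r i) - F (l i)\<bar>) < e"
        if *: "\<forall>i<n. 0 \<le> l i \<and> l i \<le> r i \<and> r i \<le> v"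
          "disjoint_family_on (\<lambda>i. {l i<..<r i}) {..<n}" "(\<Sum>i<n. r i - l i) < \<delta>"
        for n :: nat and l r
      proof -
        have "F (r i) = s (r i) \<and> F (l i) = s (l i)" if "i < n" for i
          using *(1) that by (auto intro!: F_eq intro: order_trans)
        then have "(\<Sum>i<n. \<bar>F (r i) - F (l i)\<bar>) = (\<Sum>i<n. \<bar>s (r i) - s (l i)\<bar>)" by simp
        with \<delta>(2)[OF *] show ?thesis by simp
      qed
      with \<delta>(1) show "\<exists>\<delta>>0. \<forall>(n::nat) l r. (\<forall>i<n. 0 \<le> l i \<and> l i \<le> r i \<and> r i \<le> v) \<longrightarrow>
          disjoint_family_on (\<lambda>i. {l i<..<r i}) {..<n} \<longrightarrow> (\<Sum>i<n. r i - l i) < \<delta> \<longrightarrow>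
          (\<Sum>i<n. \<bar>F (r i) - F (l i)\<bar>) < e" by blast
    qed
  qed
  have "AE x in lborel. u < x \<and> x < v \<longrightarrow> (\<forall>D. (F has_real_derivative D) (at x) \<longrightarrow> D \<le> c)"
    using AE
  proof eventually_elim
    case (elim x)
    show ?case
    proof (intro impI allI)
      fix D assume x: "u < x \<and> x < v" and D: "(F has_real_derivative D) (at x)"
      have "(s has_real_derivative D) (at x)"
        by (rule has_field_derivative_transform_within_open[OF D, of "{0<..<v}"])
          (use x uv in \<open>auto intro!: F_eq\<close>)
      then show "D \<le> c" using elim x DERIV_imp_deriv by blast
    qed
  qed
  then have "F v - F u \<le> c * (v - u)"
    using uv c by (intro F.increment_le_of_derivative_le) auto
  then show ?thesis using uv by (simp add: F_eq)
qed

text \<open>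
  On a short interval around \<open>z\<close> both \<open>K\<close> and \<open>s\<^sup>\<theta>\<close> stay within a factor \<open>r\<close> of their values at \<open>z\<close>.
  Then \<open>s'\<close> is at most \<open>\<rho> r / K z\<close> almost everywhere there, and the two terms of
  \<open>mean_q_increment\<close> are at most \<open>1 - 1/r\<^sup>2\<close> and \<open>r\<^sup>2 \<rho>\<close> times the length of the interval.
\<close>

lemma mean_q_local_bound:
  assumes z: "0 < z" and r: "1 < r" and \<rho>: "0 \<le> \<rho>"
    and AE: "AE x in lborel. 0 < x \<longrightarrow> deriv s x * K x \<le> \<rho>"
  shows "\<exists>d>0. \<forall>u v. u \<le> z \<and> z \<le> v \<and> v - u < d \<longrightarrow>
    (\<integral>x. q v x \<partial>uniform01) - (\<integral>x. q u x \<partial>uniform01) \<le> (1 - 1 / r\<^sup>2 + r\<^sup>2 * \<rho>) * (v - u)"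
proof -
  define k where "k = K z"
  define A where "A = s z powr \<theta>"
  have k: "0 < k" using z by (simp add: k_def K_pos)
  have A: "0 < A" using s_pos[OF z] by (simp add: A_def)
  have sub: "X / r < X" "X < X * r" if "0 < X" for X
    using that r by (auto simp: field_simps)
  have ap: "isCont (\<lambda>w. s w powr \<theta>) z"
    using s_pos[OF z] by (intro continuous_intros isCont_s z) auto
  have "(K \<longlongrightarrow> k) (nhds z)" "((\<lambda>w. s w powr \<theta>) \<longlongrightarrow> A) (nhds z)" "((\<lambda>w. w) \<longlongrightarrow> z) (nhds z)"
    using isCont_K[OF z] ap
      tendsto_at_iff_tendsto_nhds[of K z] tendsto_at_iff_tendsto_nhds[of "\<lambda>w. s w powr \<theta>" z]
    by (simp_all add: isCont_def k_def A_def filterlim_ident)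
  then have "\<forall>\<^sub>F w in nhds z. 0 < w \<and> k / r < K w \<and> K w < k * r \<and> A / r < s w powr \<theta> \<and> s w powr \<theta> < A * r"
    using z sub[OF k] sub[OF A] by (intro eventually_conj order_tendstoD)
  then obtain d where d: "d > 0" "\<And>w. \<bar>w - z\<bar> < d \<Longrightarrow>
      0 < w \<and> k / r < K w \<and> K w < k * r \<and> A / r < s w powr \<theta> \<and> s w powr \<theta> < A * r"
    unfolding eventually_nhds_metric dist_real_def by blast
  show ?thesis
  proof (intro exI[of _ d] conjI allI impI d(1))
    fix u v assume uv: "u \<le> z \<and> z \<le> v \<and> v - u < d"
    have near: "0 < w \<and> k / r < K w \<and> K w < k * r \<and> A / r < s w powr \<theta> \<and> s w powr \<theta> < A * r"
      if "u \<le> w" "w \<le> v" for w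
      using d(2)[of w] uv that by force
    have u0: "0 < u" and uv': "u \<le> v" using near[of u] uv by auto
    have "AE x in lborel. u < x \<and> x < v \<longrightarrow> deriv s x \<le> \<rho> * r / k"
      using AE
    proof eventually_elim
      case (elim x)
      show ?case
      proof
        assume x: "u < x \<and> x < v"
        with near[of x] have nx: "0 < x" "k / r < K x" by auto
        have kr: "0 < k / r" using k r by simp
        show "deriv s x \<le> \<rho> * r / k"
        proof (cases "0 \<le> deriv s x")
          case True
          have "deriv s x * (k / r) \<le> deriv s x * K x" using True nx by (intro mult_left_mono) auto
          also have "\<dots> \<le> \<rho>" using elim nx by simp
          finally show ?thesis using k r by (simp add: field_simps)
        next
          case False
          moreover have "0 \<le> \<rho> * r / k" using \<rho> k r by simp
          ultimately show ?thesis by linarith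
        qed
      qed
    qed
    then have s_inc: "s v - s u \<le> \<rho> * r / k * (v - u)"
      using u0 uv' \<rho> k r by (intro s_increment_le) auto
    have "K u * (s v - s u) \<le> (k * r) * (s v - s u)"
      using near[of u] uv' s_le[of u v] u0 by (intro mult_right_mono) auto
    also have "\<dots> \<le> (k * r) * (\<rho> * r / k * (v - u))"
      using s_inc k r by (intro mult_left_mono) auto
    also have "\<dots> = r\<^sup>2 * \<rho> * (v - u)" using k by (simp add: power2_eq_square)
    finally have 1: "K u * (s v - s u) \<le> r\<^sup>2 * \<rho> * (v - u)" .
    have "1 / r\<^sup>2 = (A / r) / (A * r)" using A r by (simp add: power2_eq_square)
    also have "\<dots> \<le> s u powr \<theta> / s v powr \<theta>"
      using near[of u] near[of v] uv' A r s_pos[of v] u0 by (intro frac_le) auto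
    finally have "(1 - s u powr \<theta> / s v powr \<theta>) * (v - u) \<le> (1 - 1 / r\<^sup>2) * (v - u)"
      using uv' by (intro mult_right_mono) auto
    with 1 mean_q_increment[OF u0 uv']
    show "(\<integral>x. q v x \<partial>uniform01) - (\<integral>x. q u x \<partial>uniform01) \<le> (1 - 1 / r\<^sup>2 + r\<^sup>2 * \<rho>) * (v - u)"
      by (simp add: distrib_right)
  qed
qed

text \<open>
  The inequality in \<open>mean_q_local_bound\<close> is additive over adjacent intervals, so
  bisection extends it to \<open>{a..b}\<close>; then \<open>r\<close> tends to 1 from above.
\<close>

lemma mean_q_lipschitz:
  assumes ab: "0 < a" "a \<le> b" and \<rho>: "0 \<le> \<rho>"
    and AE: "AE x in lborel. 0 < x \<longrightarrow> deriv s x * K x \<le> \<rho>"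
  shows "(\<integral>x. q b x \<partial>uniform01) - (\<integral>x. q a x \<partial>uniform01) \<le> \<rho> * (b - a)"
proof -
  have bound: "(\<integral>x. q b x \<partial>uniform01) - (\<integral>x. q a x \<partial>uniform01) \<le> (1 - 1 / r\<^sup>2 + r\<^sup>2 * \<rho>) * (b - a)"
    if r: "1 < r" for r
    using ab(2)
  proof (induction rule: Bolzano)
    case (trans u v w)
    then show ?case by (simp add: right_diff_distrib)
  next
    case (local z)
    with ab show ?case by (intro mean_q_local_bound r \<rho> AE) auto
  qed
  have "((\<lambda>r. (1 - 1 / r\<^sup>2 + r\<^sup>2 * \<rho>) * (b - a)) \<longlongrightarrow> (1 - 1 / 1\<^sup>2 + 1\<^sup>2 * \<rho>) * (b - a)) (at_right (1::real))"
    by (intro tendsto_intros) auto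
  moreover have "\<forall>\<^sub>F r in at_right (1::real).
      (\<integral>x. q b x \<partial>uniform01) - (\<integral>x. q a x \<partial>uniform01) \<le> (1 - 1 / r\<^sup>2 + r\<^sup>2 * \<rho>) * (b - a)"
    using eventually_at_right_less[of "1::real"] by (rule eventually_mono) (rule bound)
  ultimately have "(\<integral>x. q b x \<partial>uniform01) - (\<integral>x. q a x \<partial>uniform01) \<le> (1 - 1 / 1\<^sup>2 + 1\<^sup>2 * \<rho>) * (b - a)"
    by (rule tendsto_lowerbound) simp
  then show ?thesis by simp
qed

text \<open>
  The conditional expectation of \<open>h(W\<^sup>*)\<close> given \<open>W = w\<close>.
\<close>

definition smoothing :: "(real \<Rightarrow> real) \<Rightarrow> real \<Rightarrow> real" where
  "smoothing h w = (\<integral>u. h (q (w + 1) u) \<partial>uniform01)"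

text \<open>
  The increments of \<open>h\<close> are dominated by those of the identity, and \<open>q\<close> is monotone in its first
  argument, so the absolute values can be dropped and the bound for the mean applies.
\<close>

lemma smoothing_lipschitz:
  assumes h: "1-lipschitz_on UNIV h" and \<rho>: "0 \<le> \<rho>"
    and AE: "AE x in lborel. 0 < x \<longrightarrow> deriv s x * K x \<le> \<rho>"
  shows "\<rho>-lipschitz_on {0..} (smoothing h)"
proof (rule lipschitz_on_leI)
  fix w w' :: real assume w: "w \<in> {0..}" "w' \<in> {0..}" "w \<le> w'"
  interpret prob_space uniform01 by (rule prob_space_uniform01)
  note [measurable] = lipschitz_measurable[OF h]
  have int: "integrable uniform01 (\<lambda>u. h (q x u))" if "0 \<le> x" for x
  proof (rule integrable_const_bound[where B="\<bar>h 0\<bar> + x"])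
    show "AE u in uniform01. norm (h (q x u)) \<le> \<bar>h 0\<bar> + x"
    proof (rule AE_uniform01)
      fix u :: real assume "0 \<le> u" "u \<le> 1"
      then show "norm (h (q x u)) \<le> \<bar>h 0\<bar> + x"
        using abs_lipschitz[OF h, of "q x u" 0] q_nonneg[of x u] q_le[of x u] that by auto
    qed
  qed simp
  have "dist (smoothing h w) (smoothing h w') =
      \<bar>\<integral>u. h (q (w + 1) u) - h (q (w' + 1) u) \<partial>uniform01\<bar>"
    using w int by (simp add: smoothing_def dist_real_def)
  also have "\<dots> \<le> (\<integral>u. \<bar>h (q (w + 1) u) - h (q (w' + 1) u)\<bar> \<partial>uniform01)"
    by (rule integral_abs_bound)
  also have "\<dots> \<le> (\<integral>u. q (w' + 1) u - q (w + 1) u \<partial>uniform01)"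
  proof (rule integral_mono_AE)
    show "AE u in uniform01. \<bar>h (q (w + 1) u) - h (q (w' + 1) u)\<bar> \<le> q (w' + 1) u - q (w + 1) u"
    proof (rule AE_uniform01)
      fix u :: real assume "0 \<le> u" "u \<le> 1"
      then show "\<bar>h (q (w + 1) u) - h (q (w' + 1) u)\<bar> \<le> q (w' + 1) u - q (w + 1) u"
        using abs_lipschitz[OF h, of "q (w + 1) u" "q (w' + 1) u"] q_mono[of "w + 1" "w' + 1" u] w by auto
    qed
  qed (use w int q_integrable in auto)
  also have "\<dots> = (\<integral>u. q (w' + 1) u \<partial>uniform01) - (\<integral>u. q (w + 1) u \<partial>uniform01)"
    using w q_integrable by simp
  also have "\<dots> \<le> \<rho> * ((w' + 1) - (w + 1))"
    using w by (intro mean_q_lipschitz \<rho> AE) auto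
  finally show "dist (smoothing h w) (smoothing h w') \<le> \<rho> * dist w w'"
    using w by (simp add: dist_real_def)
qed (rule \<rho>)

end

section \<open>The Wasserstein contraction\<close>

lemma ess_sup_norm_leD:
  assumes "ess_sup_norm f \<le> ereal c"
  shows "AE x in lborel. 0 < x \<longrightarrow> \<bar>f x\<bar> \<le> c"
proof -
  have "AE x in lebesgue_on {0<..}. ereal \<bar>f x\<bar> \<le> ess_sup_norm f"
    unfolding ess_sup_norm_def by (rule esssup_AE)
  then have "AE x in lebesgue_on {0<..}. \<bar>f x\<bar> \<le> c"
    by (rule eventually_mono) (use assms order_trans in fastforce)
  then have "AE x in lebesgue. x \<in> {0<..} \<longrightarrow> \<bar>f x\<bar> \<le> c"
    by (subst (asm) AE_restrict_space_iff) auto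
  then show ?thesis by (simp add: AE_completion_iff)
qed

text \<open>
  Rescaling \<open>g\<close> by \<open>1/L\<close> makes it an admissible test function. For \<open>L = 0\<close> the function is constant
  and both expectations agree because the measures are probability measures.
\<close>

lemma lipschitz_integral_le_wasserstein:
  assumes \<mu>: "prob_space \<mu>" and \<nu>: "prob_space \<nu>" and g: "L-lipschitz_on UNIV (g :: real \<Rightarrow> real)"
  shows "ennreal \<bar>(LINT x|\<mu>. g x) - (LINT x|\<nu>. g x)\<bar> \<le> ennreal L * wasserstein \<mu> \<nu>"
proof (cases "L = 0")
  case True
  have "g x = g 0" for x
    using lipschitz_onD[OF g, of x 0] True by simp
  then have "g = (\<lambda>x. g 0)" by blast
  then have "(LINT x|M. g x) = g 0" if "prob_space M" for M
    using prob_space.prob_space[OF that] lebesgue_integral_const[of M "g 0"] by simp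
  then have "(LINT x|\<mu>. g x) = g 0" "(LINT x|\<nu>. g x) = g 0" using \<mu> \<nu> by auto
  then show ?thesis by simp
next
  case False
  then have L: "0 < L" using lipschitz_on_nonneg[OF g] by simp
  define h where "h = (\<lambda>x. g x / L)"
  have "1-lipschitz_on UNIV h"
  proof (rule lipschitz_onI)
    fix x y :: real
    have "dist (h x) (h y) = dist (g x) (g y) / L"
      using L by (simp add: h_def dist_real_def flip: diff_divide_distrib)
    also have "\<dots> \<le> 1 * dist x y"
      using lipschitz_onD[OF g, of x y] L by (simp add: field_simps)
    finally show "dist (h x) (h y) \<le> 1 * dist x y" .
  qed simp
  then have le: "ennreal \<bar>(LINT x|\<mu>. h x) - (LINT x|\<nu>. h x)\<bar> \<le> wasserstein \<mu> \<nu>"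
    unfolding wasserstein_def by (intro SUP_upper) simp
  have "\<bar>(LINT x|\<mu>. g x) - (LINT x|\<nu>. g x)\<bar> = L * \<bar>(LINT x|\<mu>. h x) - (LINT x|\<nu>. h x)\<bar>"
    using L by (simp add: h_def flip: diff_divide_distrib)
  then have "ennreal \<bar>(LINT x|\<mu>. g x) - (LINT x|\<nu>. g x)\<bar>
      = ennreal L * ennreal \<bar>(LINT x|\<mu>. h x) - (LINT x|\<nu>. h x)\<bar>"
    using L by (simp add: ennreal_mult)
  also have "\<dots> \<le> ennreal L * wasserstein \<mu> \<nu>" by (intro mult_left_mono le) simp
  finally show ?thesis .
qed

lemma wasserstein_finite:
  assumes X: "nonneg_random_variable M X" "integrable M X"
    and Y: "nonneg_random_variable N Y" "integrable N Y"
  shows "wasserstein (distr M borel X) (distr N borel Y) < \<infinity>"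
proof -
  interpret M: prob_space M using X by (simp add: nonneg_random_variable_def)
  interpret N: prob_space N using Y by (simp add: nonneg_random_variable_def)
  have meas [measurable]: "X \<in> borel_measurable M" "Y \<in> borel_measurable N"
    using X Y by (auto simp: nonneg_random_variable_def)
  have "wasserstein (distr M borel X) (distr N borel Y)
      \<le> ennreal ((\<integral>\<omega>. \<bar>X \<omega>\<bar> \<partial>M) + (\<integral>\<omega>. \<bar>Y \<omega>\<bar> \<partial>N))"
    unfolding wasserstein_def
  proof (rule SUP_least, clarify, rule ennreal_leI)
    fix h :: "real \<Rightarrow> real" assume h: "1-lipschitz_on UNIV h"
    note hm [measurable] = lipschitz_measurable[OF h]
    have bd: "\<bar>h x - h 0\<bar> \<le> \<bar>x\<bar>" for x using abs_lipschitz[OF h, of x 0] by simp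
    have iX: "integrable M (\<lambda>\<omega>. h (X \<omega>) - h 0)"
      by (rule Bochner_Integration.integrable_bound[OF X(2)]) (auto intro: bd)
    have iY: "integrable N (\<lambda>\<omega>. h (Y \<omega>) - h 0)"
      by (rule Bochner_Integration.integrable_bound[OF Y(2)]) (auto intro: bd)
    have "integrable M (\<lambda>\<omega>. (h (X \<omega>) - h 0) + h 0)" "integrable N (\<lambda>\<omega>. (h (Y \<omega>) - h 0) + h 0)"
      by (intro Bochner_Integration.integrable_add iX iY; simp)+
    then have iX': "integrable M (\<lambda>\<omega>. h (X \<omega>))" and iY': "integrable N (\<lambda>\<omega>. h (Y \<omega>))" by simp_all
    have "\<bar>\<integral>\<omega>. h (X \<omega>) - h 0 \<partial>M\<bar> \<le> (\<integral>\<omega>. \<bar>h (X \<omega>) - h 0\<bar> \<partial>M)" by (rule integral_abs_bound)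
    also have "\<dots> \<le> (\<integral>\<omega>. \<bar>X \<omega>\<bar> \<partial>M)" using iX X(2) by (intro integral_mono bd) auto
    finally have 1: "\<bar>(\<integral>\<omega>. h (X \<omega>) \<partial>M) - h 0\<bar> \<le> (\<integral>\<omega>. \<bar>X \<omega>\<bar> \<partial>M)"
      using iX' by (simp add: M.prob_space)
    have "\<bar>\<integral>\<omega>. h (Y \<omega>) - h 0 \<partial>N\<bar> \<le> (\<integral>\<omega>. \<bar>h (Y \<omega>) - h 0\<bar> \<partial>N)" by (rule integral_abs_bound)
    also have "\<dots> \<le> (\<integral>\<omega>. \<bar>Y \<omega>\<bar> \<partial>N)" using iY Y(2) by (intro integral_mono bd) auto
    finally have 2: "\<bar>(\<integral>\<omega>. h (Y \<omega>) \<partial>N) - h 0\<bar> \<le> (\<integral>\<omega>. \<bar>Y \<omega>\<bar> \<partial>N)"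
      using iY' by (simp add: N.prob_space)
    have "(LINT x|distr M borel X. h x) = (\<integral>\<omega>. h (X \<omega>) \<partial>M)"
      "(LINT x|distr N borel Y. h x) = (\<integral>\<omega>. h (Y \<omega>) \<partial>N)"
      by (simp_all add: integral_distr)
    then show "\<bar>(LINT x|distr M borel X. h x) - (LINT x|distr N borel Y. h x)\<bar>
      \<le> (\<integral>\<omega>. \<bar>X \<omega>\<bar> \<partial>M) + (\<integral>\<omega>. \<bar>Y \<omega>\<bar> \<partial>N)" using 1 2 by linarith
  qed
  also have "\<dots> < \<infinity>" by simp
  finally show ?thesis .
qed

context dickman_utility
begin

text \<open>
  The test functions of the Wasserstein distance live on the whole real line, hence the extension by a
  constant to the left of 0, where \<open>W\<close> takes no values.
\<close>

lemma smoothing_extension_lipschitz: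
  assumes "1-lipschitz_on UNIV h" "0 \<le> \<rho>"
    and "AE x in lborel. 0 < x \<longrightarrow> deriv s x * K x \<le> \<rho>"
  shows "\<rho>-lipschitz_on UNIV (\<lambda>w. smoothing h (max 0 w))"
proof (rule lipschitz_onI)
  fix x y :: real
  have "dist (smoothing h (max 0 x)) (smoothing h (max 0 y)) \<le> \<rho> * dist (max 0 x) (max 0 y)"
    by (rule lipschitz_onD[OF smoothing_lipschitz[OF assms]]) auto
  also have "\<dots> \<le> \<rho> * dist x y" using assms(2) by (intro mult_left_mono) (auto simp: dist_real_def)
  finally show "dist (smoothing h (max 0 x)) (smoothing h (max 0 y)) \<le> \<rho> * dist x y" .
qed (rule assms)

text \<open>
  Fubini's theorem; the integrand is dominated by \<open>|h 0| + W + 1\<close>, since \<open>0 \<le> W\<^sup>* \<le> W + 1\<close>.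
\<close>

lemma integral_star_law:
  assumes W: "nonneg_random_variable M W" "integrable M W" and h: "1-lipschitz_on UNIV h"
  shows "(LINT x|star_law \<theta> s M W. h x) = (\<integral>\<omega>. smoothing h (W \<omega>) \<partial>M)"
proof -
  interpret M: prob_space M using W by (simp add: nonneg_random_variable_def)
  interpret U: prob_space uniform01 by (rule prob_space_uniform01)
  interpret UM: pair_sigma_finite uniform01 M ..
  have Wm [measurable]: "W \<in> borel_measurable M" and W0: "\<And>\<omega>. \<omega> \<in> space M \<Longrightarrow> 0 \<le> W \<omega>"
    using W by (auto simp: nonneg_random_variable_def)
  note hm [measurable] = lipschitz_measurable[OF h]
  have s0: "(\<lambda>w. s (max 0 w)) \<in> borel_measurable borel"
    by (intro borel_measurable_continuous_onI continuous_on_compose2[OF continuous_s])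
      (auto intro!: continuous_intros)
  have "(\<lambda>\<omega>. s (max 0 (W \<omega> + 1))) \<in> borel_measurable M"
    by (rule measurable_compose[OF _ s0]) simp
  also have "?this \<longleftrightarrow> (\<lambda>\<omega>. s (W \<omega> + 1)) \<in> borel_measurable M"
    using W0 by (intro measurable_cong) (simp add: max_def)
  finally have sW [measurable]: "(\<lambda>\<omega>. s (W \<omega> + 1)) \<in> borel_measurable M" .
  let ?T = "\<lambda>(u, \<omega>). q (W \<omega> + 1) u"
  have T [measurable]: "?T \<in> borel_measurable (uniform01 \<Otimes>\<^sub>M M)"
    unfolding q_def by measurable
  have star: "star_law \<theta> s M W = distr (uniform01 \<Otimes>\<^sub>M M) borel ?T"
    unfolding star_law_def q_def \<sigma>_def ..
  have dom: "\<bar>h (q (W \<omega> + 1) u)\<bar> \<le> \<bar>h 0\<bar> + (W \<omega> + 1)"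
    if "0 \<le> u" "u \<le> 1" "\<omega> \<in> space M" for u \<omega>
    using abs_lipschitz[OF h, of "q (W \<omega> + 1) u" 0] that W0[of \<omega>]
      q_nonneg[of "W \<omega> + 1" u] q_le[of "W \<omega> + 1" u] by auto
  have dom_int: "integrable M (\<lambda>\<omega>. \<bar>h 0\<bar> + (W \<omega> + 1))"
    using W(2) by (intro Bochner_Integration.integrable_add) auto
  have slice: "integrable M (\<lambda>\<omega>. h (q (W \<omega> + 1) u))" if "0 \<le> u" "u \<le> 1" for u
  proof (rule Bochner_Integration.integrable_bound[OF dom_int])
    show "(\<lambda>\<omega>. h (q (W \<omega> + 1) u)) \<in> borel_measurable M" unfolding q_def by measurable
    show "AE \<omega> in M. norm (h (q (W \<omega> + 1) u)) \<le> norm (\<bar>h 0\<bar> + (W \<omega> + 1))"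
      using dom[OF that] W0 by (intro AE_I2) force
  qed
  have int: "integrable (uniform01 \<Otimes>\<^sub>M M) (\<lambda>(u, \<omega>). h (q (W \<omega> + 1) u))"
  proof (rule UM.Fubini_integrable)
    show "(\<lambda>(u, \<omega>). h (q (W \<omega> + 1) u)) \<in> borel_measurable (uniform01 \<Otimes>\<^sub>M M)"
      unfolding q_def by measurable
    show "AE u in uniform01. integrable M (\<lambda>\<omega>. case (u, \<omega>) of (u, \<omega>) \<Rightarrow> h (q (W \<omega> + 1) u))"
      using slice by (intro AE_uniform01) auto
    show "integrable uniform01 (\<lambda>u. \<integral>\<omega>. norm (case (u, \<omega>) of (u, \<omega>) \<Rightarrow> h (q (W \<omega> + 1) u)) \<partial>M)"
    proof (rule U.integrable_const_bound[where B="\<integral>\<omega>. \<bar>h 0\<bar> + (W \<omega> + 1) \<partial>M"])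
      show "(\<lambda>u. \<integral>\<omega>. norm (case (u, \<omega>) of (u, \<omega>) \<Rightarrow> h (q (W \<omega> + 1) u)) \<partial>M) \<in> borel_measurable uniform01"
        unfolding q_def by measurable
      show "AE u in uniform01. norm (\<integral>\<omega>. norm (case (u, \<omega>) of (u, \<omega>) \<Rightarrow> h (q (W \<omega> + 1) u)) \<partial>M)
          \<le> (\<integral>\<omega>. \<bar>h 0\<bar> + (W \<omega> + 1) \<partial>M)"
      proof (rule AE_uniform01)
        fix u :: real assume u: "0 \<le> u" "u \<le> 1"
        have "(\<integral>\<omega>. \<bar>h (q (W \<omega> + 1) u)\<bar> \<partial>M) \<le> (\<integral>\<omega>. \<bar>h 0\<bar> + (W \<omega> + 1) \<partial>M)"
          by (rule integral_mono[OF integrable_abs[OF slice[OF u]] dom_int dom[OF u]])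
        then show "norm (\<integral>\<omega>. norm (case (u, \<omega>) of (u, \<omega>) \<Rightarrow> h (q (W \<omega> + 1) u)) \<partial>M)
          \<le> (\<integral>\<omega>. \<bar>h 0\<bar> + (W \<omega> + 1) \<partial>M)" by simp
      qed
    qed
  qed
  have "(LINT x|star_law \<theta> s M W. h x) = (\<integral>z. h (?T z) \<partial>(uniform01 \<Otimes>\<^sub>M M))"
    unfolding star by (rule integral_distr) (simp_all add: T)
  also have "\<dots> = (\<integral>z. (\<lambda>(u, \<omega>). h (q (W \<omega> + 1) u)) z \<partial>(uniform01 \<Otimes>\<^sub>M M))"
    by (intro Bochner_Integration.integral_cong) auto
  also have "\<dots> = (\<integral>\<omega>. (\<integral>u. h (q (W \<omega> + 1) u) \<partial>uniform01) \<partial>M)"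
    using UM.integral_snd[OF int] by simp
  finally show ?thesis by (simp add: smoothing_def)
qed

lemma integral_star_law_distr:
  assumes X: "nonneg_random_variable M X" "integrable M X" and h: "1-lipschitz_on UNIV h"
    and meas: "(\<lambda>w. smoothing h (max 0 w)) \<in> borel_measurable borel"
  shows "(LINT x|star_law \<theta> s M X. h x) = (LINT x|distr M borel X. smoothing h (max 0 x))"
proof -
  have "(LINT x|distr M borel X. smoothing h (max 0 x)) = (\<integral>\<omega>. smoothing h (max 0 (X \<omega>)) \<partial>M)"
    using X meas by (intro integral_distr) (auto simp: nonneg_random_variable_def)
  also have "\<dots> = (\<integral>\<omega>. smoothing h (X \<omega>) \<partial>M)"
    using X by (intro Bochner_Integration.integral_cong) (auto simp: nonneg_random_variable_def max_def)
  finally show ?thesis using integral_star_law[OF X h] by simp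
qed

text \<open>
  The expectation of \<open>h(W\<^sup>*)\<close> is that of the \<open>\<rho>\<close>-Lipschitz function \<open>g(W)\<close>, where \<open>g\<close> is the
  extended smoothing of \<open>h\<close>.
\<close>

lemma star_law_contraction:
  assumes W: "nonneg_random_variable M W" "integrable M W"
    and D: "nonneg_random_variable N D" "integrable N D"
    and h: "1-lipschitz_on UNIV h" and \<rho>: "0 \<le> \<rho>"
    and AE: "AE x in lborel. 0 < x \<longrightarrow> deriv s x * K x \<le> \<rho>"
  shows "ennreal \<bar>(LINT x|star_law \<theta> s M W. h x) - (LINT x|star_law \<theta> s N D. h x)\<bar>
    \<le> ennreal \<rho> * wasserstein (distr M borel W) (distr N borel D)"
proof -
  let ?g = "\<lambda>w. smoothing h (max 0 w)"
  have g: "\<rho>-lipschitz_on UNIV ?g" by (rule smoothing_extension_lipschitz[OF h \<rho> AE])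
  have gm: "?g \<in> borel_measurable borel"
    by (intro borel_measurable_continuous_onI lipschitz_on_continuous_on[OF g])
  have "prob_space (distr M borel W)" "prob_space (distr N borel D)"
    using W D by (auto simp: nonneg_random_variable_def intro: prob_space.prob_space_distr)
  from lipschitz_integral_le_wasserstein[OF this g] show ?thesis
    unfolding integral_star_law_distr[OF W h gm] integral_star_law_distr[OF D h gm] .
qed

end

text \<open>
  The triangle inequality through \<open>W\<^sup>*\<close>, the fixed point property of \<open>D\<close> and the contraction give
  \<open>d \<le> a + \<rho> d\<close>; finiteness of \<open>d\<close> is needed to solve this for \<open>d\<close>.
\<close>

lemma dickman_wasserstein_bound:
  assumes \<theta>: "0 < \<theta>" and s: "utility_function s"
    and D: "dickman_variable \<theta> s N D" "integrable N D"
    and \<rho>: "0 \<le> \<rho>" "\<rho> < 1" and I: "ess_sup_norm (dickman_I \<theta> s) \<le> ereal \<rho>"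
    and W: "nonneg_random_variable M W" "integrable M W"
  shows "wasserstein (distr M borel W) (distr N borel D)
    \<le> ennreal (inverse (1 - \<rho>)) * wasserstein (star_law \<theta> s M W) (distr M borel W)"
proof -
  interpret dickman_utility \<theta> s by standard (fact \<theta> s)+
  let ?d = "wasserstein (distr M borel W) (distr N borel D)"
  let ?a = "wasserstein (star_law \<theta> s M W) (distr M borel W)"
  have Dn: "nonneg_random_variable N D" and fixpoint: "distr N borel D = star_law \<theta> s N D"
    using D by (auto simp: dickman_variable_def)
  have I_eq: "dickman_I \<theta> s x = deriv s x * K x" for x
    by (simp add: dickman_I_def K_def J_def)
  have AE: "AE x in lborel. 0 < x \<longrightarrow> deriv s x * K x \<le> \<rho>"
    using ess_sup_norm_leD[OF I] unfolding I_eq by (rule eventually_mono) auto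
  have d_le: "?d \<le> ?a + ennreal \<rho> * ?d"
  proof -
    have "ennreal \<bar>(LINT x|distr M borel W. h x) - (LINT x|distr N borel D. h x)\<bar> \<le> ?a + ennreal \<rho> * ?d"
      if h: "1-lipschitz_on UNIV h" for h
    proof -
      let ?W = "LINT x|distr M borel W. h x" and ?W' = "LINT x|star_law \<theta> s M W. h x"
        and ?D = "LINT x|distr N borel D. h x"
      have "ennreal \<bar>?W - ?D\<bar> \<le> ennreal (\<bar>?W' - ?W\<bar> + \<bar>?W' - ?D\<bar>)"
        by (intro ennreal_leI) linarith
      also have "\<dots> = ennreal \<bar>?W' - ?W\<bar> + ennreal \<bar>?W' - ?D\<bar>" by simp
      also have "\<dots> \<le> ?a + ennreal \<rho> * ?d"
      proof (rule add_mono)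
        show "ennreal \<bar>?W' - ?W\<bar> \<le> ?a"
          unfolding wasserstein_def using h by (intro SUP_upper) simp
        show "ennreal \<bar>?W' - ?D\<bar> \<le> ennreal \<rho> * ?d"
          using star_law_contraction[OF W Dn D(2) h \<rho>(1) AE] unfolding fixpoint[symmetric] .
      qed
      finally show ?thesis .
    qed
    then show ?thesis
      by (subst wasserstein_def[of "distr M borel W" "distr N borel D"]) (rule SUP_least, simp)
  qed
  have "?d < \<infinity>" by (rule wasserstein_finite[OF W Dn D(2)])
  then obtain d where d: "?d = ennreal d" "0 \<le> d" by (cases ?d rule: ennreal_cases) auto
  show ?thesis
  proof (cases ?a rule: ennreal_cases)
    case (real a)
    have "ennreal d \<le> ennreal (a + \<rho> * d)"
      using d_le real d \<rho> by (simp add: ennreal_mult)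
    moreover have "0 \<le> a + \<rho> * d" using real d \<rho> by simp
    ultimately have "d \<le> a + \<rho> * d" by (simp only: ennreal_le_iff)
    then have "d \<le> inverse (1 - \<rho>) * a" using \<rho> by (simp add: field_simps)
    then have "ennreal d \<le> ennreal (inverse (1 - \<rho>) * a)" by (rule ennreal_leI)
    also have "\<dots> = ennreal (inverse (1 - \<rho>)) * ennreal a" using \<rho> real by (intro ennreal_mult) auto
    finally show ?thesis using d real by simp
  next
    case top
    moreover have "ennreal (inverse (1 - \<rho>)) \<noteq> 0" using \<rho> by simp
    ultimately show ?thesis by (simp add: ennreal_mult_top)
  qed
qed

section \<open>The linear utility function\<close>

lemma utility_function_id: "utility_function (\<lambda>x. x)"
proof -
  have "absolutely_continuous_on_interval c d (\<lambda>x. x)" for c d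
    unfolding absolutely_continuous_on_interval_def
  proof (intro allI impI)
    fix e :: real assume "0 < e"
    moreover have "(\<Sum>i<n. \<bar>r i - l i\<bar>) < e"
      if "\<forall>i<n. c \<le> l i \<and> l i \<le> r i \<and> r i \<le> d" "(\<Sum>i<n. r i - l i) < e" for n :: nat and l r
    proof -
      have "(\<Sum>i<n. \<bar>r i - l i\<bar>) = (\<Sum>i<n. r i - l i)" using that by (intro sum.cong) auto
      with that show ?thesis by simp
    qed
    ultimately show "\<exists>\<delta>>0. \<forall>(n::nat) l r. (\<forall>i<n. c \<le> l i \<and> l i \<le> r i \<and> r i \<le> d) \<longrightarrow>
        disjoint_family_on (\<lambda>i. {l i<..<r i}) {..<n} \<longrightarrow> (\<Sum>i<n. r i - l i) < \<delta> \<longrightarrow>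
        (\<Sum>i<n. \<bar>r i - l i\<bar>) < e" by blast
  qed
  then show ?thesis by (auto simp: utility_function_def strict_mono_on_def)
qed

lemma dickman_I_id:
  assumes "0 < \<theta>" "0 < x"
  shows "dickman_I \<theta> (\<lambda>x. x) x = \<theta> / (\<theta> + 1)"
proof -
  have "((\<lambda>v. v powr \<theta>) has_integral (x powr (\<theta> + 1) / (\<theta> + 1))) {0..x}"
    using assms by (intro has_integral_powr_from_0) auto
  then have "integral {0..x} (\<lambda>v. v powr \<theta>) = x powr (\<theta> + 1) / (\<theta> + 1)"
    by (rule integral_unique)
  then show ?thesis using assms by (simp add: dickman_I_def)
qed

lemma ess_sup_norm_dickman_I_id:
  assumes \<theta>: "0 < \<theta>"
  shows "ess_sup_norm (dickman_I \<theta> (\<lambda>x. x)) = ereal (\<theta> / (\<theta> + 1))"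
proof -
  let ?L = "lebesgue_on {0::real<..}" and ?c = "ereal (\<theta> / (\<theta> + 1))"
  have eq: "ereal \<bar>dickman_I \<theta> (\<lambda>x. x) x\<bar> = ?c" if "x \<in> space ?L" for x
    using that \<theta> by (simp add: dickman_I_id space_restrict_space)
  have "(\<lambda>x. ereal \<bar>dickman_I \<theta> (\<lambda>x. x) x\<bar>) \<in> borel_measurable ?L"
    by (subst measurable_cong[OF eq]) simp_all
  then have "ess_sup_norm (dickman_I \<theta> (\<lambda>x. x)) = esssup ?L (\<lambda>x. ?c)"
    unfolding ess_sup_norm_def by (rule esssup_AE_cong) (use \<theta> in \<open>auto intro!: AE_I2 simp: dickman_I_id\<close>)
  also have "\<dots> = ?c"
  proof (rule esssup_const)
    have "emeasure lebesgue {0<..1::real} \<le> emeasure lebesgue {0::real<..}"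
      by (rule emeasure_mono) auto
    then show "emeasure ?L (space ?L) \<noteq> 0"
      by (auto simp: emeasure_restrict_space space_restrict_space)
  qed
  finally show ?thesis .
qed

theorem theorem3p4:
  fixes \<theta> :: real
  assumes "\<theta> > 0"
  shows
    "(\<forall>(s :: real \<Rightarrow> real) (N :: 'b measure) D \<rho>.
        utility_function s \<longrightarrow>
        dickman_variable \<theta> s N D \<longrightarrow>
        integrable N D \<longrightarrow>
        0 \<le> \<rho> \<longrightarrow> \<rho> < 1 \<longrightarrow>
        ess_sup_norm (dickman_I \<theta> s) \<le> ereal \<rho> \<longrightarrow>
        (\<forall>(M :: 'a measure) W.
           nonneg_random_variable M W \<longrightarrow> integrable M W \<longrightarrow>
           wasserstein (distr M borel W) (distr N borel D)
             \<le> ennreal (inverse (1 - \<rho>)) * wasserstein (star_law \<theta> s M W) (distr M borel W)))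
     \<and>
     ess_sup_norm (dickman_I \<theta> (\<lambda>x. x)) = ereal (\<theta> / (\<theta> + 1)) \<and>
     \<theta> / (\<theta> + 1) \<in> {0..<1} \<and>
     (\<forall>(N :: 'b measure) D.
        dickman_variable \<theta> (\<lambda>x. x) N D \<longrightarrow>
        (\<forall>(M :: 'a measure) W.
           nonneg_random_variable M W \<longrightarrow> integrable M W \<longrightarrow>
           wasserstein (distr M borel W) (distr N borel D)
             \<le> ennreal (inverse (1 - \<theta> / (\<theta> + 1))) *
                 wasserstein (star_law \<theta> (\<lambda>x. x) M W) (distr M borel W)))"
proof -
  have range: "\<theta> / (\<theta> + 1) \<in> {0..<1}" using assms by simp
  have ess: "ess_sup_norm (dickman_I \<theta> (\<lambda>x. x)) = ereal (\<theta> / (\<theta> + 1))"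
    using assms by (rule ess_sup_norm_dickman_I_id)
  have special: "wasserstein (distr M borel W) (distr N borel D)
      \<le> ennreal (inverse (1 - \<theta> / (\<theta> + 1))) *
          wasserstein (star_law \<theta> (\<lambda>x. x) M W) (distr M borel W)"
    if "dickman_variable \<theta> (\<lambda>x. x) N D" "nonneg_random_variable M W" "integrable M W"
    for N :: "'b measure" and D and M :: "'a measure" and W
    using that range ess
    by (intro dickman_wasserstein_bound[OF assms utility_function_id]) (auto simp: dickman_variable_def)
  show ?thesis
    using dickman_wasserstein_bound[OF assms] ess range special by blast
qed

end
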